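(* Let $(X,T)$ be a topological dynamical system with the marker property. Then there is a metric $d'$ on $X$ compatible with its topology such that $mdim(X,T)=mdim_{d'}(X,T)$.
   Context: A topological dynamical system $(X,T)$ is a compact metric space $X$ together with a homeomorphism $T:X\to X$. Marker property: a subset $F\subset X$ is an $n$-marker ($n\in\mathbb{N}$) if (1) $F\cap T^{i}(F)=\emptyset$ for $i=1,\ldots,n-1$, and (2) there is $m\in\mathbb{N}$ such that the sets $T^{i}(F)$, $1\le i\le m$, cover $X$. $(X,T)$ has the marker property if it has an open $n$-marker for every $n\in\mathbb{N}$. Mean dimension: for a finite open cover $\alpha$ of $X$, $ord(\alpha)=\max_{x\in X}\sum_{U\in\alpha}1_U(x)-1$ and $D(\alpha)=\min_{\beta\succ\alpha}ord(\beta)$, the minimum over finite open covers $\beta$ refining $\alpha$; $mdim(X,T)=\sup_{\alpha}\lim_{n\to\infty}\frac{D(\alpha^n)}{n}$ with $\alpha^n=\bigvee_{i=0}^{n-1}T^{-i}\alpha$. Metric mean dimension: for a compatible metric $d$, a set $S\subset X$ is $(n,\epsilon,d)$-spanning if for every $x\in X$ there is $y\in S$ with $d(T^kx,T^ky)<\epsilon$ for all $0\le k<n$. Let $A(n,\epsilon,d)$ be the minimal cardinality of an $(n,\epsilon,d)$-spanning set, $s(\epsilon,d)=\limsup_{n\to\infty}\frac{\log A(n,\epsilon,d)}{n}$, and $mdim_d(X,T)=\liminf_{\epsilon\to0}\frac{s(\epsilon,d)}{|\log\epsilon|}$. *)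

theory Defs
  imports "HOL-Analysis.Analysis"
begin

text \<open>
  The phase space is a whole type \<open>'a\<close>, hence never empty; this is what makes the maximum in
  the order of a cover meaningful.
\<close>

section \<open>Marker property\<close>

definition marker :: "('a \<Rightarrow> 'a) \<Rightarrow> nat \<Rightarrow> 'a set \<Rightarrow> bool" where
  "marker T n F \<longleftrightarrow>
     (\<forall>i\<in>{1..<n}. F \<inter> (T ^^ i) ` F = {}) \<and>
     (\<exists>m. (\<Union>i\<in>{1..m}. (T ^^ i) ` F) = UNIV)"

definition marker_property :: "('a::topological_space \<Rightarrow> 'a) \<Rightarrow> bool" where
  "marker_property T \<longleftrightarrow> (\<forall>n. \<exists>F. open F \<and> marker T n F)"

section \<open>Mean dimension\<close>

definition finite_open_covers :: "'a::topological_space set set set" where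
  "finite_open_covers = {\<alpha>. finite \<alpha> \<and> (\<forall>U\<in>\<alpha>. open U) \<and> \<Union>\<alpha> = UNIV}"

definition finer_cover :: "'a set set \<Rightarrow> 'a set set \<Rightarrow> bool" where
  "finer_cover \<beta> \<alpha> \<longleftrightarrow> (\<forall>V\<in>\<beta>. \<exists>U\<in>\<alpha>. V \<subseteq> U)"

text \<open>
  For a cover the maximum is at least 1, so the subtraction on \<^typ>\<open>nat\<close> does not truncate.
\<close>

definition cover_ord :: "'a set set \<Rightarrow> nat" where
  "cover_ord \<alpha> = Max (range (\<lambda>x. \<Sum>U\<in>\<alpha>. indicator U x)) - 1"

text \<open>
  An infimum of a nonempty set of natural numbers is attained, so it is a minimum; the set is
  nonempty for \<open>\<alpha> \<in> finite_open_covers\<close>, since \<open>\<alpha>\<close> refines itself.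
\<close>

definition cover_dim :: "'a::topological_space set set \<Rightarrow> nat" where
  "cover_dim \<alpha> = (INF \<beta>\<in>{\<beta>\<in>finite_open_covers. finer_cover \<beta> \<alpha>}. cover_ord \<beta>)"

text \<open>The join of the covers \<open>T\<^sup>-\<^sup>i \<alpha>\<close> for \<open>0 \<le> i < n\<close>; a member is given by a choice \<open>U\<close> of one
  element of \<open>\<alpha>\<close> for each \<open>i\<close>.\<close>

definition iterated_cover :: "('a \<Rightarrow> 'a) \<Rightarrow> 'a set set \<Rightarrow> nat \<Rightarrow> 'a set set" where
  "iterated_cover T \<alpha> n = {\<Inter>i<n. (T ^^ i) -` U i | U. \<forall>i<n. U i \<in> \<alpha>}"

text \<open>
  For continuous \<open>T\<close> the limit exists, because the cover dimension of the iterated cover is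
  subadditive in \<open>n\<close>. The supremum may be infinite.
\<close>

definition mdim :: "('a::topological_space \<Rightarrow> 'a) \<Rightarrow> ereal" where
  "mdim T = (SUP \<alpha>\<in>finite_open_covers.
     lim (\<lambda>n. ereal (real (cover_dim (iterated_cover T \<alpha> n)) / real n)))"

section \<open>Metric mean dimension\<close>

definition compatible_metric :: "('a::topological_space \<Rightarrow> 'a \<Rightarrow> real) \<Rightarrow> bool" where
  "compatible_metric d \<longleftrightarrow>
     Metric_space UNIV d \<and> Metric_space.mtopology UNIV d = euclidean"

definition spanning :: "('a \<Rightarrow> 'a) \<Rightarrow> nat \<Rightarrow> real \<Rightarrow> ('a \<Rightarrow> 'a \<Rightarrow> real) \<Rightarrow> 'a set \<Rightarrow> bool" where
  "spanning T n \<epsilon> d S \<longleftrightarrow>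
     (\<forall>x. \<exists>y\<in>S. \<forall>k<n. d ((T ^^ k) x) ((T ^^ k) y) < \<epsilon>)"

text \<open>
  Finiteness is imposed because \<^const>\<open>card\<close> is 0 on infinite sets; on a compact space with a
  compatible metric, finite spanning sets exist for every \<open>\<epsilon> > 0\<close> if \<open>T\<close> is continuous.
\<close>

definition spanning_number :: "('a \<Rightarrow> 'a) \<Rightarrow> nat \<Rightarrow> real \<Rightarrow> ('a \<Rightarrow> 'a \<Rightarrow> real) \<Rightarrow> nat" where
  "spanning_number T n \<epsilon> d = (INF S\<in>{S. finite S \<and> spanning T n \<epsilon> d S}. card S)"

definition scale_entropy :: "('a \<Rightarrow> 'a) \<Rightarrow> real \<Rightarrow> ('a \<Rightarrow> 'a \<Rightarrow> real) \<Rightarrow> ereal" where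
  "scale_entropy T \<epsilon> d =
     limsup (\<lambda>n. ereal (ln (real (spanning_number T n \<epsilon> d)) / real n))"

definition metric_mdim :: "('a \<Rightarrow> 'a) \<Rightarrow> ('a \<Rightarrow> 'a \<Rightarrow> real) \<Rightarrow> ereal" where
  "metric_mdim T d = Liminf (at_right 0) (\<lambda>\<epsilon>. scale_entropy T \<epsilon> d / ereal \<bar>ln \<epsilon>\<bar>)"

end

theory Submission
  imports Defs
begin

text \<open>
  For any compatible metric, covering the image of an orbit map in a cube by few small cubes leaves
  a grid point that shares only few coordinates with each point of the image; pushing away from it
  maps the space to a low-dimensional skeleton, and this bounds the mean dimension from above by the
  metric mean dimension.

  Conversely, let \<open>\<gamma>\<close> refine the join of \<open>T\<^sup>-\<^sup>i \<alpha>\<close> over a block of \<open>N\<close> times. At each time \<open>r\<close> of the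
  block the space is cut along the level \<open>c\<^sub>r\<close> of bump functions subordinate to \<open>\<gamma>\<close>. The levels
  being distinct, a bump function is near at most one of them, so the total multiplicity of the cuts
  over a block exceeds \<open>N\<close> by at most the order of \<open>\<gamma>\<close>. Sparse markers tell when blocks begin, and
  a marker is again accepted by a level that depends on its age, so that it is ambiguous at one time
  only. This gives covers finer than \<open>\<alpha>\<close> whose order, averaged along orbits, is nearly the mean
  dimension. A continuous pseudometric can be changed by an arbitrarily small amount into one that is
  a Lipschitz function of bumps subordinate to such a cover, and is therefore cheap to span at a small
  scale; the metric is a limit of such changes, each too small to spoil the earlier scales.
\<close>

section \<open>Nerves and bump functions\<close>

text \<open>What links the two notions is a count along orbits. If the multiplicity of a cover,
  minus one, sums to at most nD + C over n times, then bump values over n times have at most nD + C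
  entries strictly between 0 and 1. Only these are resolved at scale 1/q, at a cost of ln (q + 1)
  each. Recording which entries are 0, 1 or fractional costs ln 3 apiece, a constant that the
  division by |ln \<epsilon>| removes.

  The obstacle is that mean dimension provides efficient covers only for blocks of time, while the
  count needs one cover of the space that works along whole orbits. A fixed division of time into
  blocks is not a function of the point; the markers give a division that is. Breaking a block off
  early loses at most a fixed multiple of the order of \<open>\<gamma>\<close>, which long gaps
  between markers make negligible.

  Metric mean dimension is a lower limit, so one good scale below every \<delta> > 0 is enough, and
  each change of the metric has to serve a single scale only. If the mean dimension is infinite, the
  first inequality makes every compatible metric a solution.\<close>

lemma cover_ord_le:
  assumes "finite \<beta>" and "\<And>x. card {U\<in>\<beta>. x \<in> U} \<le> Suc k"
  shows "cover_ord \<beta> \<le> k"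
proof -
  have eq: "(\<Sum>U\<in>\<beta>. indicator U x) = card {U\<in>\<beta>. x \<in> U}" for x
    using assms(1) by (simp add: indicator_def sum.If_cases Int_def)
  have "range (\<lambda>x. \<Sum>U\<in>\<beta>. indicator U x :: nat) \<subseteq> {..Suc k}"
    using eq assms(2) by auto
  then have "finite (range (\<lambda>x. \<Sum>U\<in>\<beta>. indicator U x :: nat))"
    by (rule finite_subset) simp
  then have "Max (range (\<lambda>x. \<Sum>U\<in>\<beta>. indicator U x :: nat)) \<le> Suc k"
    using eq assms(2) by (subst Max_le_iff) auto
  then show ?thesis unfolding cover_ord_def by simp
qed

lemma card_le_cover_ord:
  assumes "finite \<beta>"
  shows "card {U\<in>\<beta>. x \<in> U} \<le> Suc (cover_ord \<beta>)"
proof -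
  have eq: "(\<Sum>U\<in>\<beta>. indicator U x) = card {U\<in>\<beta>. x \<in> U}" for x
    using assms(1) by (simp add: indicator_def sum.If_cases Int_def)
  have "range (\<lambda>x. \<Sum>U\<in>\<beta>. indicator U x :: nat) \<subseteq> {..card \<beta>}"
    using eq assms by (auto intro!: card_mono)
  then have "finite (range (\<lambda>x. \<Sum>U\<in>\<beta>. indicator U x :: nat))"
    by (rule finite_subset) simp
  then have "(\<Sum>U\<in>\<beta>. indicator U x :: nat) \<le> Max (range (\<lambda>x. \<Sum>U\<in>\<beta>. indicator U x :: nat))"
    by (intro Max_ge) auto
  then show ?thesis unfolding cover_ord_def eq by simp
qed

lemma cover_dim_le:
  assumes "\<beta> \<in> finite_open_covers" "finer_cover \<beta> \<alpha>" "cover_ord \<beta> \<le> k"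
  shows "cover_dim \<alpha> \<le> k"
  using assms unfolding cover_dim_def
  by (intro order_trans[OF cINF_lower[of _ _ \<beta>]]) auto

lemma cover_dim_attained:
  assumes "\<alpha> \<in> finite_open_covers"
  obtains \<beta> where "\<beta> \<in> finite_open_covers" "finer_cover \<beta> \<alpha>"
    "\<And>x. card {U\<in>\<beta>. x \<in> U} \<le> Suc (cover_dim \<alpha>)"
proof -
  let ?A = "{\<beta>\<in>finite_open_covers. finer_cover \<beta> \<alpha>}"
  have "\<alpha> \<in> ?A" using assms by (auto simp: finer_cover_def)
  then have "cover_ord ` ?A \<noteq> {}" by blast
  then have "Inf (cover_ord ` ?A) \<in> cover_ord ` ?A" by (rule Inf_nat_def1)
  then obtain \<beta> where "\<beta> \<in> ?A" "cover_ord \<beta> = cover_dim \<alpha>"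
    unfolding cover_dim_def by auto
  then show thesis using card_le_cover_ord[of \<beta>] that[of \<beta>]
    by (auto simp: finite_open_covers_def)
qed

text \<open>The cell of a set \<open>C\<close> consists of the points at which \<open>C\<close> collects the largest
  values of \<open>r\<close>. The cells containing a given point form a chain, so at most one of them has a
  given size.\<close>

lemma cover_dim_le_nerve:
  fixes r :: "'e \<Rightarrow> 'a::topological_space \<Rightarrow> real"
  assumes fin: "finite E" and cont: "\<And>e. e \<in> E \<Longrightarrow> continuous_on UNIV (r e)"
    and le1: "\<And>e x. e \<in> E \<Longrightarrow> r e x \<le> 1"
    and full: "\<And>g x. g \<in> grp ` E \<Longrightarrow> \<exists>e\<in>E. grp e = g \<and> r e x = 1"
    and count: "\<And>x. card {e\<in>E. r e x > 0} \<le> card (grp ` E) + K"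
    and sub: "\<And>C. C \<subseteq> E \<Longrightarrow> grp ` C = grp ` E \<Longrightarrow> \<exists>U\<in>\<alpha>. {x. \<forall>e\<in>C. r e x > 0} \<subseteq> U"
  shows "cover_dim \<alpha> \<le> K"
proof -
  define cell where "cell C = {x. (\<forall>e\<in>C. r e x > 0) \<and> (\<forall>e\<in>C. \<forall>f\<in>E-C. r f x < r e x)}" for C
  define CC where "CC = {C. C \<subseteq> E \<and> grp ` C = grp ` E}"
  have finCC: "finite CC" unfolding CC_def using fin by simp
  have "open (cell C)" if "C \<in> CC" for C
  proof -
    have C: "C \<subseteq> E" "finite C" using that fin finite_subset by (auto simp: CC_def)
    have "cell C = (\<Inter>e\<in>C. {x. r e x > 0}) \<inter> (\<Inter>e\<in>C. \<Inter>f\<in>E-C. {x. r f x < r e x})"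
      unfolding cell_def by auto
    also have "open \<dots>"
      using C fin by (intro open_Int open_INT finite_Diff ballI open_Collect_less cont) auto
    finally show ?thesis .
  qed
  moreover have "x \<in> \<Union>(cell ` CC)" for x
  proof -
    \<comment> \<open>These bumps meet every group by \<open>full\<close>, and they exceed all the
      others strictly because no value is larger than 1.\<close>
    let ?C = "{e\<in>E. r e x = 1}"
    have "g \<in> grp ` ?C" if g: "g \<in> grp ` E" for g
      using full[OF g, of x] by (elim bexE) (auto intro!: image_eqI)
    then have "grp ` ?C = grp ` E" by (intro antisym image_mono subsetI) auto
    then have "?C \<in> CC" by (auto simp: CC_def)
    moreover have "x \<in> cell ?C"
    proof -
      have "r f x < 1" if "f \<in> E - ?C" for f using le1[of f x] that by (auto simp: order.strict_iff_order)
      then show ?thesis by (simp add: cell_def)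
    qed
    ultimately show ?thesis by blast
  qed
  ultimately have cover: "cell ` CC \<in> finite_open_covers"
    using finCC by (auto simp: finite_open_covers_def)
  have finer: "finer_cover (cell ` CC) \<alpha>"
    unfolding finer_cover_def
  proof
    fix V assume "V \<in> cell ` CC"
    then obtain C where C: "C \<in> CC" "V = cell C" by auto
    then obtain U where "U \<in> \<alpha>" "{x. \<forall>e\<in>C. r e x > 0} \<subseteq> U" using sub[of C] by (auto simp: CC_def)
    then show "\<exists>U\<in>\<alpha>. V \<subseteq> U" using C by (auto simp: cell_def)
  qed
  have "card {U \<in> cell ` CC. x \<in> U} \<le> Suc K" for x
  proof -
    let ?D = "{C\<in>CC. x \<in> cell C}"
    have chain: "C \<subseteq> C' \<or> C' \<subseteq> C" if "C \<in> ?D" "C' \<in> ?D" for C C'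
    proof (rule ccontr)
      assume "\<not> ?thesis"
      then obtain e f where "e \<in> C" "e \<notin> C'" "f \<in> C'" "f \<notin> C" by blast
      moreover from this that have "e \<in> E" "f \<in> E" by (auto simp: CC_def)
      ultimately have "r f x < r e x" "r e x < r f x" using that by (auto simp: cell_def)
      then show False by simp
    qed
    have inj: "inj_on card ?D"
    proof (rule inj_onI)
      fix C C' assume *: "C \<in> ?D" "C' \<in> ?D" "card C = card C'"
      then have "finite C" "finite C'" using fin finite_subset by (auto simp: CC_def)
      with chain[OF *(1,2)] *(3) show "C = C'" by (metis card_subset_eq)
    qed
    \<comment> \<open>A set in \<open>CC\<close> has at least one element per group, and one whose
      cell contains \<open>x\<close> consists of bumps positive at \<open>x\<close>. By
      \<open>count\<close> only \<open>K + 1\<close> sizes remain.\<close>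
    have "card ` ?D \<subseteq> {card (grp ` E)..card (grp ` E) + K}"
    proof clarify
      fix C assume C: "C \<in> CC" "x \<in> cell C"
      then have "finite C" "grp ` C = grp ` E" using fin finite_subset by (auto simp: CC_def)
      then have "card (grp ` E) \<le> card C" using card_image_le by metis
      moreover have "card C \<le> card {e\<in>E. r e x > 0}"
        using C fin by (intro card_mono) (auto simp: CC_def cell_def)
      ultimately show "card C \<in> {card (grp ` E)..card (grp ` E) + K}" using count[of x] by simp
    qed
    then have "card (card ` ?D) \<le> card {card (grp ` E)..card (grp ` E) + K}"
      by (intro card_mono) auto
    then have "card ?D \<le> Suc K" using card_image[OF inj] by simp
    moreover have "{U \<in> cell ` CC. x \<in> U} \<subseteq> cell ` ?D" by auto
    then have "card {U \<in> cell ` CC. x \<in> U} \<le> card ?D"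
      by (rule surj_card_le[rotated]) (use finCC in auto)
    ultimately show ?thesis by simp
  qed
  then have "cover_ord (cell ` CC) \<le> K" using finCC by (intro cover_ord_le) auto
  with cover finer show ?thesis by (rule cover_dim_le)
qed

section \<open>Compatible metrics and Lipschitz bump functions\<close>

lemma compatible_metricD:
  assumes "compatible_metric d"
  shows "d x x = 0" "d x y = d y x" "d x z \<le> d x y + d y z" "0 \<le> d x y"
    and "open U \<Longrightarrow> x \<in> U \<Longrightarrow> \<exists>e>0. \<forall>y. d x y < e \<longrightarrow> y \<in> U"
    and "e > 0 \<Longrightarrow> \<exists>V. open V \<and> x \<in> V \<and> (\<forall>y\<in>V. d x y < e)"
proof -
  interpret M: Metric_space UNIV d using assms by (simp add: compatible_metric_def)
  have top: "M.mtopology = euclidean" using assms by (simp add: compatible_metric_def)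
  show "d x x = 0" "0 \<le> d x y" by auto
  show "d x y = d y x" using M.commute by simp
  show "d x z \<le> d x y + d y z" using M.triangle by simp
  show "\<exists>e>0. \<forall>y. d x y < e \<longrightarrow> y \<in> U" if U: "open U" and x: "x \<in> U"
  proof -
    have "openin M.mtopology U" using U top by simp
    then obtain e where "e > 0" "M.mball x e \<subseteq> U" using x M.openin_mtopology by blast
    then show ?thesis by (auto simp: M.mball_def)
  qed
  show "\<exists>V. open V \<and> x \<in> V \<and> (\<forall>y\<in>V. d x y < e)" if "e > 0"
  proof -
    have "openin M.mtopology (M.mball x e)" by (rule M.openin_mball)
    then have "open (M.mball x e)" using top by simp
    then show ?thesis using that by (intro exI[of _ "M.mball x e"]) (auto simp: M.mball_def)
  qed
qed

lemma lipschitz_continuous_on: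
  fixes f :: "'a::t2_space \<Rightarrow> real"
  assumes "compatible_metric d" and lip: "\<And>x y. \<bar>f x - f y\<bar> \<le> C * d x y"
  shows "continuous_on UNIV f"
proof -
  have "isCont f x" for x
    unfolding continuous_at tendsto_iff
  proof (intro allI impI)
    fix e :: real assume "e > 0"
    then obtain V where V: "open V" "x \<in> V" "\<forall>y\<in>V. d x y < e / (\<bar>C\<bar> + 1)"
      using compatible_metricD(6)[OF assms(1), of "e / (\<bar>C\<bar> + 1)" x] by (auto simp: field_simps)
    have "dist (f y) (f x) < e" if "y \<in> V" for y
    proof -
      have "\<bar>f x - f y\<bar> \<le> C * d x y" by (rule lip)
      also have "\<dots> \<le> (\<bar>C\<bar> + 1) * d x y"
        using compatible_metricD(4)[OF assms(1), of x y] by (intro mult_right_mono) auto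
      also have "\<dots> < e" using V(3) that by (auto simp: field_simps)
      finally show ?thesis by (simp add: dist_real_def abs_minus_commute)
    qed
    then show "\<forall>\<^sub>F y in at x. dist (f y) (f x) < e"
      using V(1,2) unfolding eventually_at_topological by blast
  qed
  then show ?thesis by (simp add: continuous_at_imp_continuous_on)
qed

lemma compatible_dist:
  "compatible_metric (dist :: 'a::metric_space \<Rightarrow> 'a \<Rightarrow> real)"
  unfolding compatible_metric_def
  using Met_TC.Metric_space_axioms by simp

lemma lipschitz_distance_to_complement:
  fixes U :: "'a::topological_space set"
  assumes "compatible_metric d" "open U"
  obtains f where "\<And>x. 0 \<le> f x" "\<And>x. f x > 0 \<longleftrightarrow> x \<in> U" "\<And>x y. \<bar>f x - f y\<bar> \<le> d x y"
\<comment> \<open>With an empty complement there is no distance to take, and the constant 1 serves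
  instead.\<close>
proof (cases "U = UNIV")
  case True
  then show thesis using that[of "\<lambda>_. 1"] compatible_metricD(4)[OF assms(1)] by auto
next
  case False
  note m = compatible_metricD[OF assms(1)]
  define f where "f x = (INF y\<in>-U. d x y)" for x
  have ne: "-U \<noteq> {}" using False by auto
  have bdd: "bdd_below (d x ` (-U))" for x using m(4) by (auto intro!: bdd_belowI[of _ 0])
  have low: "f x \<le> d x y" if "y \<notin> U" for x y
    unfolding f_def using bdd that by (intro cINF_lower) auto
  have ge: "c \<le> f x" if "\<And>y. y \<notin> U \<Longrightarrow> c \<le> d x y" for x c
    unfolding f_def using ne that by (intro cINF_greatest) auto
  have half: "f x \<le> f y + d x y" for x y
  proof -
    have "f x - d x y \<le> d y z" if "z \<notin> U" for z using low[OF that, of x] m(3)[of x z y] by linarith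
    from ge[of "f x - d x y" y, OF this] show ?thesis by linarith
  qed
  have "\<bar>f x - f y\<bar> \<le> d x y" for x y using half[of x y] half[of y x] m(2)[of x y] by linarith
  moreover have pos: "0 \<le> f x" for x using ge m(4) by auto
  moreover have "f x > 0 \<longleftrightarrow> x \<in> U" for x
  proof
    assume "x \<in> U"
    then obtain e where e: "e > 0" "\<forall>y. d x y < e \<longrightarrow> y \<in> U" using m(5)[OF assms(2)] by blast
    then have "e \<le> f x" by (intro ge) force
    then show "f x > 0" using e by simp
  next
    assume "f x > 0" then show "x \<in> U" using low[of x x] m(1) by force
  qed
  ultimately show thesis using that by blast
qed

text \<open>Normalised by the maximum rather than by the sum. Since some bump always equals 1, every
  level below 1 is exceeded somewhere in the family, and the number of fractional values at a point
  is at least one less than the multiplicity of the cover there.\<close>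

definition bumps :: "'i set \<Rightarrow> ('i \<Rightarrow> 'a::topological_space set) \<Rightarrow> ('i \<Rightarrow> 'a \<Rightarrow> real) \<Rightarrow> bool" where
  "bumps I U p \<longleftrightarrow>
     (\<forall>i\<in>I. continuous_on UNIV (p i) \<and> (\<forall>x. 0 \<le> p i x \<and> p i x \<le> 1 \<and> (p i x > 0 \<longrightarrow> x \<in> U i))) \<and>
     (\<forall>x. \<exists>i\<in>I. p i x = 1)"

lemma bumpsD:
  assumes "bumps I U p"
  shows "i \<in> I \<Longrightarrow> continuous_on UNIV (p i)" "i \<in> I \<Longrightarrow> 0 \<le> p i x" "i \<in> I \<Longrightarrow> p i x \<le> 1"
    "i \<in> I \<Longrightarrow> p i x > 0 \<Longrightarrow> x \<in> U i" "\<exists>i\<in>I. p i x = 1"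
  using assms by (auto simp: bumps_def)

text \<open>The distances to the complements have a sum that is positive everywhere, hence at least
  some \<open>l\<close> > 0 by compactness. So at each point one of them is at least
  \<open>l / k\<close>, where \<open>k\<close> is their number. Scaling by \<open>k / l\<close> and
  truncating at 1 gives the value 1 there and keeps the Lipschitz property.\<close>

lemma lipschitz_bumps:
  fixes U :: "'i \<Rightarrow> 'a::t2_space set"
  assumes "compatible_metric d" "compact (UNIV :: 'a set)" "finite I"
    "\<And>i. i \<in> I \<Longrightarrow> open (U i)" "(\<Union>i\<in>I. U i) = UNIV"
  obtains p C where "C > 0" "bumps I U p" "\<And>i x y. i \<in> I \<Longrightarrow> \<bar>p i x - p i y\<bar> \<le> C * d x y"
proof -
  have "\<forall>i\<in>I. \<exists>f. (\<forall>x. 0 \<le> f x) \<and> (\<forall>x. f x > 0 \<longleftrightarrow> x \<in> U i) \<and> (\<forall>x y. \<bar>f x - f y\<bar> \<le> d x y)"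
    using lipschitz_distance_to_complement[OF assms(1) assms(4)] by metis
  then obtain f where f: "\<And>i x. i \<in> I \<Longrightarrow> 0 \<le> f i x" "\<And>i x. i \<in> I \<Longrightarrow> f i x > 0 \<longleftrightarrow> x \<in> U i"
      "\<And>i x y. i \<in> I \<Longrightarrow> \<bar>f i x - f i y\<bar> \<le> d x y"
    by (metis (no_types))
  have fc: "continuous_on UNIV (f i)" if "i \<in> I" for i
    using f(3)[OF that] by (intro lipschitz_continuous_on[OF assms(1), of _ 1]) auto
  obtain x0 where x0: "\<And>x. (\<Sum>i\<in>I. f i x0) \<le> (\<Sum>i\<in>I. f i x)"
    using continuous_attains_inf[OF assms(2), of "\<lambda>x. \<Sum>i\<in>I. f i x"] fc
    by (auto intro: continuous_on_sum)
  define l where "l = (\<Sum>i\<in>I. f i x0)"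
  have "l > 0"
  proof -
    obtain i where "i \<in> I" "x0 \<in> U i" using assms(5) by blast
    then show ?thesis unfolding l_def using f assms(3) by (intro sum_pos2[of _ i]) auto
  qed
  define k where "k = real (card I)"
  have "I \<noteq> {}" using assms(5) by auto
  then have "k > 0" using assms(3) by (simp add: k_def card_gt_0_iff)
  define C where "C = k / l"
  have "C > 0" using \<open>l > 0\<close> \<open>k > 0\<close> by (simp add: C_def)
  define p where "p i x = min 1 (C * f i x)" for i x
  have "\<exists>i\<in>I. p i x = 1" for x
  proof (rule ccontr)
    assume "\<not> ?thesis"
    then have "\<forall>i\<in>I. f i x < l / k" using \<open>l > 0\<close> \<open>k > 0\<close>
      by (auto simp: p_def C_def min_def field_simps split: if_splits)
    then have "(\<Sum>i\<in>I. f i x) < (\<Sum>i\<in>I. l / k)" using \<open>I \<noteq> {}\<close> assms(3) by (intro sum_strict_mono) auto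
    also have "\<dots> = l" using \<open>k > 0\<close> by (simp add: k_def)
    finally show False using x0[of x] by (simp add: l_def)
  qed
  moreover have lip: "\<bar>p i x - p i y\<bar> \<le> C * d x y" if "i \<in> I" for i x y
  proof -
    have "\<bar>p i x - p i y\<bar> \<le> \<bar>C * f i x - C * f i y\<bar>" unfolding p_def by linarith
    also have "\<dots> = C * \<bar>f i x - f i y\<bar>"
      using \<open>C > 0\<close> by (simp add: abs_mult flip: right_diff_distrib)
    also have "\<dots> \<le> C * d x y" using f(3)[OF that] \<open>C > 0\<close> by (intro mult_left_mono) auto
    finally show ?thesis .
  qed
  moreover have "continuous_on UNIV (p i)" if "i \<in> I" for i
    using lip[OF that] by (rule lipschitz_continuous_on[OF assms(1)])
  moreover have "x \<in> U i" if "i \<in> I" "p i x > 0" for i x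
    using that f(2)[OF that(1), of x] \<open>C > 0\<close> by (auto simp: p_def zero_less_mult_iff)
  moreover have "0 \<le> p i x" "p i x \<le> 1" if "i \<in> I" for i x
    using \<open>C > 0\<close> f(1)[OF that, of x] by (auto simp: p_def)
  ultimately have "bumps I U p" by (auto simp: bumps_def)
  then show thesis using \<open>C > 0\<close> lip that by blast
qed

section \<open>Subadditivity of the cover dimension\<close>

text \<open>Fekete's lemma: the limit is the infimum. Division with remainder by an \<open>N\<close>
  whose ratio is nearly minimal bounds all later ratios, the remainders contributing a bounded
  amount to \<open>a n\<close>.\<close>

lemma subadditive_ratio_tendsto:
  fixes a :: "nat \<Rightarrow> nat"
  assumes sub: "\<And>m n. a (m + n) \<le> a m + a n"
  obtains L where "(\<lambda>n. real (a n) / real n) \<longlonglongrightarrow> L" "\<And>n. n \<ge> 1 \<Longrightarrow> L \<le> real (a n) / real n"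
proof -
  define L where "L = (INF n\<in>{1..}. real (a n) / real n)"
  have bdd: "bdd_below ((\<lambda>n. real (a n) / real n) ` {1..})" by (auto intro!: bdd_belowI[of _ 0])
  have low: "L \<le> real (a n) / real n" if "n \<ge> 1" for n
    unfolding L_def using bdd that by (intro cINF_lower) auto
  have "(\<lambda>n. real (a n) / real n) \<longlonglongrightarrow> L"
  proof (rule order_tendstoI)
    fix c assume "c < L"
    then show "\<forall>\<^sub>F n in sequentially. c < real (a n) / real n"
      using low by (intro eventually_sequentiallyI[of 1]) (auto intro: less_le_trans)
  next
    fix c assume "L < c"
    then obtain N where N: "N \<ge> 1" "real (a N) / real N < c"
      unfolding L_def using cINF_less_iff[OF _ bdd] by auto
    define B where "B = (\<Sum>r<N. a r)"
    have mult: "a (k * N + r) \<le> k * a N + a r" for k r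
    proof (induction k)
      case (Suc k)
      have "a (Suc k * N + r) \<le> a N + a (k * N + r)" using sub[of N "k * N + r"] by (simp add: add.assoc)
      then show ?case using Suc by simp
    qed simp
    have bound: "real (a n) / real n \<le> real (a N) / real N + real B / real n" if "n \<ge> 1" for n
    proof -
      have "a (n mod N) \<le> B" unfolding B_def using N(1) by (intro member_le_sum) auto
      then have "a n \<le> (n div N) * a N + B" using mult[of "n div N" "n mod N"] by simp
      then have "real (a n) \<le> real (n div N) * real (a N) + real B"
        by (metis of_nat_add of_nat_le_iff of_nat_mult)
      also have "\<dots> \<le> (real n / real N) * real (a N) + real B"
        by (intro add_right_mono mult_right_mono of_nat_div_le_of_nat) auto
      finally show ?thesis using that N(1) by (simp add: field_simps)
    qed
    have "(\<lambda>n. real (a N) / real N + real B / real n) \<longlonglongrightarrow> real (a N) / real N + 0"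
      by (intro tendsto_add tendsto_const lim_const_over_n)
    then have "\<forall>\<^sub>F n in sequentially. real (a N) / real N + real B / real n < c"
      using N(2) by (intro order_tendstoD(2)) auto
    then show "\<forall>\<^sub>F n in sequentially. real (a n) / real n < c"
      using eventually_ge_at_top[of 1] by eventually_elim (use bound in force)
  qed
  then show thesis using low that by blast
qed

lemma bumps_exist:
  fixes U :: "'i \<Rightarrow> 'a::metric_space set"
  assumes "compact (UNIV :: 'a set)" "finite I" "\<And>i. i \<in> I \<Longrightarrow> open (U i)" "(\<Union>i\<in>I. U i) = UNIV"
  obtains p where "bumps I U p"
proof -
  obtain p :: "'i \<Rightarrow> 'a \<Rightarrow> real" where "bumps I U p"
  proof (rule lipschitz_bumps[OF compatible_dist assms])
    fix p :: "'i \<Rightarrow> 'a \<Rightarrow> real" assume "bumps I U p"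
    then show thesis by (rule that)
  qed
  then show thesis by (rule that)
qed

lemma cover_bumps:
  fixes \<beta> :: "'a::metric_space set set"
  assumes "compact (UNIV :: 'a set)" "\<beta> \<in> finite_open_covers"
  obtains p where "bumps \<beta> (\<lambda>V. V) p"
proof (rule bumps_exist[OF assms(1)])
  show "finite \<beta>" "\<And>V. V \<in> \<beta> \<Longrightarrow> open V" "(\<Union>V\<in>\<beta>. V) = UNIV"
    using assms(2) by (auto simp: finite_open_covers_def)
qed (rule that)

lemma subset_iterated_coverI:
  assumes "\<And>i. i < n \<Longrightarrow> \<exists>U\<in>\<alpha>. A \<subseteq> (T ^^ i) -` U"
  shows "\<exists>W\<in>iterated_cover T \<alpha> n. A \<subseteq> W"
proof -
  obtain U where U: "\<And>i. i < n \<Longrightarrow> U i \<in> \<alpha> \<and> A \<subseteq> (T ^^ i) -` U i" using assms by metis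
  then have "(\<Inter>i<n. (T ^^ i) -` U i) \<in> iterated_cover T \<alpha> n" by (auto simp: iterated_cover_def)
  moreover have "A \<subseteq> (\<Inter>i<n. (T ^^ i) -` U i)" using U by auto
  ultimately show ?thesis by (rule bexI[rotated])
qed

lemma iterated_coverD:
  assumes "W \<in> iterated_cover T \<alpha> n" "i < n"
  shows "\<exists>U\<in>\<alpha>. W \<subseteq> (T ^^ i) -` U"
proof -
  obtain U where "W = (\<Inter>i<n. (T ^^ i) -` U i)" "\<forall>i<n. U i \<in> \<alpha>"
    using assms(1) by (auto simp: iterated_cover_def)
  then show ?thesis using assms(2) by (intro bexI[of _ "U i"]) auto
qed

section \<open>Iterated covers of a continuous map\<close>

locale compact_dynamics =
  fixes T :: "'a::metric_space \<Rightarrow> 'a"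
  assumes compact: "compact (UNIV :: 'a set)" and cont: "continuous_on UNIV T"
begin

lemma continuous_funpow: "continuous_on UNIV (T ^^ n)"
proof (induction n)
  case 0
  then show ?case by (simp add: id_def)
next
  case (Suc n)
  then show ?case using continuous_on_compose[of UNIV "T ^^ n" T] cont continuous_on_subset by auto
qed

lemma iterated_cover_open_cover:
  assumes "\<alpha> \<in> finite_open_covers"
  shows "iterated_cover T \<alpha> n \<in> finite_open_covers"
proof -
  have \<alpha>: "finite \<alpha>" "\<And>U. U \<in> \<alpha> \<Longrightarrow> open U" "\<Union>\<alpha> = UNIV" using assms by (auto simp: finite_open_covers_def)
  have "iterated_cover T \<alpha> n \<subseteq> (\<lambda>U. \<Inter>i<n. (T ^^ i) -` U i) ` PiE {..<n} (\<lambda>_. \<alpha>)"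
  proof
    fix W assume "W \<in> iterated_cover T \<alpha> n"
    then obtain U where U: "W = (\<Inter>i<n. (T ^^ i) -` U i)" "\<forall>i<n. U i \<in> \<alpha>" by (auto simp: iterated_cover_def)
    then have "W = (\<Inter>i<n. (T ^^ i) -` restrict U {..<n} i)" by auto
    moreover have "restrict U {..<n} \<in> PiE {..<n} (\<lambda>_. \<alpha>)" using U(2) by auto
    ultimately show "W \<in> (\<lambda>U. \<Inter>i<n. (T ^^ i) -` U i) ` PiE {..<n} (\<lambda>_. \<alpha>)" by (rule image_eqI)
  qed
  then have "finite (iterated_cover T \<alpha> n)" by (rule finite_subset) (simp add: \<alpha>(1) finite_PiE)
  moreover have "open W" if "W \<in> iterated_cover T \<alpha> n" for W
    using that \<alpha>(2) open_vimage[OF _ continuous_funpow] unfolding iterated_cover_def by (auto intro!: open_INT)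
  moreover have "x \<in> \<Union>(iterated_cover T \<alpha> n)" for x
  proof -
    have "\<exists>W\<in>iterated_cover T \<alpha> n. {x} \<subseteq> W" using \<alpha>(3) by (intro subset_iterated_coverI) auto
    then show ?thesis by blast
  qed
  ultimately show ?thesis by (auto simp: finite_open_covers_def)
qed

text \<open>The nerve bound is used with two groups: bumps of an optimal cover for the first
  \<open>m\<close> times, and bumps of one for the next \<open>n\<close> times, composed with
  \<open>T ^^ m\<close>. Each group has at most its order plus one positive members at a point, and
  these two extra units are exactly the number of groups.\<close>

lemma cover_dim_iterated_subadditive:
  assumes "\<alpha> \<in> finite_open_covers"
  shows "cover_dim (iterated_cover T \<alpha> (m + n))
       \<le> cover_dim (iterated_cover T \<alpha> m) + cover_dim (iterated_cover T \<alpha> n)"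
proof -
  obtain \<beta> where \<beta>: "\<beta> \<in> finite_open_covers" "finer_cover \<beta> (iterated_cover T \<alpha> m)"
    "\<And>x. card {U\<in>\<beta>. x \<in> U} \<le> Suc (cover_dim (iterated_cover T \<alpha> m))"
    using cover_dim_attained[OF iterated_cover_open_cover[OF assms, of m]] by blast
  obtain \<gamma> where \<gamma>: "\<gamma> \<in> finite_open_covers" "finer_cover \<gamma> (iterated_cover T \<alpha> n)"
    "\<And>x. card {U\<in>\<gamma>. x \<in> U} \<le> Suc (cover_dim (iterated_cover T \<alpha> n))"
    using cover_dim_attained[OF iterated_cover_open_cover[OF assms, of n]] by blast
  obtain p where "bumps \<beta> (\<lambda>V. V) p" by (rule cover_bumps[OF compact \<beta>(1)])
  note p = bumpsD(3,4,5,1)[OF this]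
  obtain q where "bumps \<gamma> (\<lambda>V. V) q" by (rule cover_bumps[OF compact \<gamma>(1)])
  note q = bumpsD(3,4,5,1)[OF this]
  have fin: "finite \<beta>" "finite \<gamma>" and ne: "\<beta> \<noteq> {}" "\<gamma> \<noteq> {}"
    using \<beta>(1) \<gamma>(1) by (auto simp: finite_open_covers_def)
  define E where "E = \<beta> <+> \<gamma>"
  define r where "r e = (case e of Inl U \<Rightarrow> p U | Inr V \<Rightarrow> q V \<circ> (T ^^ m))" for e
  have grpE: "isl ` E = {True, False}" using ne by (auto simp: E_def Plus_def image_Un image_image)
  show ?thesis
  proof (rule cover_dim_le_nerve[where E = E and r = r and grp = isl])
    show "finite E" using fin by (simp add: E_def)
    have "continuous_on UNIV (q V \<circ> (T ^^ m))" if "V \<in> \<gamma>" for V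
      using continuous_on_subset[OF q(4)[OF that]] by (intro continuous_on_compose continuous_funpow) auto
    then show "continuous_on UNIV (r e)" if "e \<in> E" for e
      using that p(4) by (auto simp: r_def E_def)
    show "r e x \<le> 1" if "e \<in> E" for e x using that p(1) q(1) by (auto simp: r_def E_def)
    show "\<exists>e\<in>E. isl e = g \<and> r e x = 1" for g x
    proof (cases g)
      case True
      obtain V where "V \<in> \<beta>" "p V x = 1" using p(3) by blast
      then show ?thesis using True by (intro bexI[of _ "Inl V"]) (auto simp: E_def r_def)
    next
      case False
      obtain V where "V \<in> \<gamma>" "q V ((T ^^ m) x) = 1" using q(3) by blast
      then show ?thesis using False by (intro bexI[of _ "Inr V"]) (auto simp: E_def r_def)
    qed
    show "card {e \<in> E. r e x > 0} \<le> card (isl ` E) +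
      (cover_dim (iterated_cover T \<alpha> m) + cover_dim (iterated_cover T \<alpha> n))" for x
    proof -
      have "{e \<in> E. r e x > 0} \<subseteq> {U\<in>\<beta>. x \<in> U} <+> {V\<in>\<gamma>. (T ^^ m) x \<in> V}"
        using p(2) q(2) by (auto simp: E_def r_def)
      then have "card {e \<in> E. r e x > 0} \<le> card {U\<in>\<beta>. x \<in> U} + card {V\<in>\<gamma>. (T ^^ m) x \<in> V}"
        using fin by (subst card_Plus[symmetric]) (auto intro!: card_mono)
      then show ?thesis using \<beta>(3)[of x] \<gamma>(3)[of "(T ^^ m) x"] by (simp add: grpE)
    qed
    show "\<exists>W\<in>iterated_cover T \<alpha> (m + n). {x. \<forall>e\<in>C. r e x > 0} \<subseteq> W"
      if C: "C \<subseteq> E" "isl ` C = isl ` E" for C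
    proof -
      have "True \<in> isl ` C" "False \<in> isl ` C" unfolding C(2) grpE by auto
      then obtain e f where ef: "e \<in> C" "isl e" "f \<in> C" "\<not> isl f" by (elim imageE) blast
      then obtain U where "Inl U \<in> C" by (cases e) auto
      moreover obtain V where "Inr V \<in> C" using ef by (cases f) auto
      ultimately have UV: "Inl U \<in> C" "Inr V \<in> C" .
      then have "U \<in> \<beta>" "V \<in> \<gamma>" using C(1) by (auto simp: E_def)
      then obtain U' V' where *: "U' \<in> iterated_cover T \<alpha> m" "U \<subseteq> U'" "V' \<in> iterated_cover T \<alpha> n" "V \<subseteq> V'"
        using \<beta>(2) \<gamma>(2) unfolding finer_cover_def by meson
      have sub: "{x. \<forall>e\<in>C. r e x > 0} \<subseteq> U \<inter> (T ^^ m) -` V"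
      proof clarify
        fix x assume "\<forall>e\<in>C. r e x > 0"
        then have "r (Inl U) x > 0" "r (Inr V) x > 0" using UV by auto
        then show "x \<in> U \<inter> (T ^^ m) -` V" using p(2) q(2) \<open>U \<in> \<beta>\<close> \<open>V \<in> \<gamma>\<close> by (auto simp: r_def)
      qed
      show ?thesis
      proof (rule subset_iterated_coverI)
        fix i assume i: "i < m + n"
        show "\<exists>W\<in>\<alpha>. {x. \<forall>e\<in>C. r e x > 0} \<subseteq> (T ^^ i) -` W"
        proof (cases "i < m")
          case True
          then obtain W where W: "W \<in> \<alpha>" "U' \<subseteq> (T ^^ i) -` W" using iterated_coverD[OF *(1)] by blast
          have "{x. \<forall>e\<in>C. r e x > 0} \<subseteq> U" using sub by (rule order_trans) simp
          also note *(2)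
          also note W(2)
          finally show ?thesis using W(1) by (rule bexI)
        next
          case False
          then have "i - m < n" and pow: "T ^^ i = (T ^^ (i - m)) \<circ> (T ^^ m)"
            using i funpow_add[of "i - m" m T] by auto
          then obtain W where W: "W \<in> \<alpha>" "V' \<subseteq> (T ^^ (i - m)) -` W" using iterated_coverD[OF *(3)] by blast
          have "{x. \<forall>e\<in>C. r e x > 0} \<subseteq> (T ^^ m) -` V" using sub by (rule order_trans) simp
          also have "\<dots> \<subseteq> (T ^^ m) -` ((T ^^ (i - m)) -` W)" using *(4) W(2) by (intro vimage_mono) simp
          also have "\<dots> = (T ^^ i) -` W" by (simp add: pow vimage_comp)
          finally show ?thesis using W(1) by (rule bexI)
        qed
      qed
    qed
  qed
qed

definition cover_mdim :: "'a set set \<Rightarrow> real" where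
  "cover_mdim \<alpha> = lim (\<lambda>n. real (cover_dim (iterated_cover T \<alpha> n)) / real n)"

lemma
  assumes "\<alpha> \<in> finite_open_covers"
  shows tendsto_cover_mdim:
      "(\<lambda>n. real (cover_dim (iterated_cover T \<alpha> n)) / real n) \<longlonglongrightarrow> cover_mdim \<alpha>"
    and cover_mdim_le: "n \<ge> 1 \<Longrightarrow> cover_mdim \<alpha> \<le> real (cover_dim (iterated_cover T \<alpha> n)) / real n"
proof -
  obtain L where L: "(\<lambda>n. real (cover_dim (iterated_cover T \<alpha> n)) / real n) \<longlonglongrightarrow> L"
    "\<And>n. n \<ge> 1 \<Longrightarrow> L \<le> real (cover_dim (iterated_cover T \<alpha> n)) / real n"
    using subadditive_ratio_tendsto[of "\<lambda>n. cover_dim (iterated_cover T \<alpha> n)"]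
      cover_dim_iterated_subadditive[OF assms] by blast
  then have "cover_mdim \<alpha> = L" unfolding cover_mdim_def by (rule_tac limI)
  with L show "(\<lambda>n. real (cover_dim (iterated_cover T \<alpha> n)) / real n) \<longlonglongrightarrow> cover_mdim \<alpha>"
    "n \<ge> 1 \<Longrightarrow> cover_mdim \<alpha> \<le> real (cover_dim (iterated_cover T \<alpha> n)) / real n" by auto
qed

lemma cover_mdim_nonneg: "\<alpha> \<in> finite_open_covers \<Longrightarrow> 0 \<le> cover_mdim \<alpha>"
  by (rule tendsto_lowerbound[OF tendsto_cover_mdim]) (assumption, rule always_eventually, simp, simp)

lemma mdim_eq: "mdim T = (SUP \<alpha>\<in>finite_open_covers. ereal (cover_mdim \<alpha>))"
  unfolding mdim_def
proof (rule SUP_cong[OF refl])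
  fix \<alpha> :: "'a set set" assume "\<alpha> \<in> finite_open_covers"
  from tendsto_ereal[OF tendsto_cover_mdim[OF this]]
  show "lim (\<lambda>n. ereal (real (cover_dim (iterated_cover T \<alpha> n)) / real n)) = ereal (cover_mdim \<alpha>)"
    by (rule limI)
qed

section \<open>Spanning numbers\<close>

lemma spanning_number_attained:
  assumes "compatible_metric d" "\<epsilon> > 0"
  obtains S where "finite S" "spanning T n \<epsilon> d S" "card S = spanning_number T n \<epsilon> d"
proof -
  note m = compatible_metricD[OF assms(1)]
  have "\<exists>V. open V \<and> x \<in> V \<and> (\<forall>y\<in>V. \<forall>k<n. d ((T ^^ k) x) ((T ^^ k) y) < \<epsilon>)" for x
  proof -
    have "\<forall>k. \<exists>V. open V \<and> (T ^^ k) x \<in> V \<and> (\<forall>y\<in>V. d ((T ^^ k) x) y < \<epsilon>)"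
      using m(6)[OF assms(2)] by simp
    from choice[OF this] obtain V
      where V: "\<And>k. open (V k) \<and> (T ^^ k) x \<in> V k \<and> (\<forall>y\<in>V k. d ((T ^^ k) x) y < \<epsilon>)" by auto
    have "open (\<Inter>k<n. (T ^^ k) -` V k)" using V open_vimage[OF _ continuous_funpow] by auto
    then show ?thesis using V by (intro exI[of _ "\<Inter>k<n. (T ^^ k) -` V k"]) auto
  qed
  then have "\<forall>x. \<exists>V. open V \<and> x \<in> V \<and> (\<forall>y\<in>V. \<forall>k<n. d ((T ^^ k) x) ((T ^^ k) y) < \<epsilon>)" by simp
  from choice[OF this] obtain V where V: "\<And>x. open (V x)" "\<And>x. x \<in> V x"
      "\<And>x y k. y \<in> V x \<Longrightarrow> k < n \<Longrightarrow> d ((T ^^ k) x) ((T ^^ k) y) < \<epsilon>"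
    by auto
  obtain S where S: "finite S" "UNIV \<subseteq> (\<Union>x\<in>S. V x)"
  proof (rule compactE_image[OF compact, of UNIV V])
    show "UNIV \<subseteq> (\<Union>x\<in>UNIV. V x)" using V(2) by auto
    show "open (V x)" for x by (rule V(1))
    fix S assume "finite S" "UNIV \<subseteq> (\<Union>x\<in>S. V x)"
    then show thesis by (rule that)
  qed
  have "spanning T n \<epsilon> d S"
    unfolding spanning_def
  proof
    fix x
    obtain y where "y \<in> S" "x \<in> V y" using S(2) by blast
    then show "\<exists>y\<in>S. \<forall>k<n. d ((T ^^ k) x) ((T ^^ k) y) < \<epsilon>" using V(3) m(2) by metis
  qed
  then have "card ` {S. finite S \<and> spanning T n \<epsilon> d S} \<noteq> {}" using S(1) by blast
  then have "Inf (card ` {S. finite S \<and> spanning T n \<epsilon> d S}) \<in> card ` {S. finite S \<and> spanning T n \<epsilon> d S}"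
    by (rule Inf_nat_def1)
  then show thesis using that unfolding spanning_number_def by auto
qed

lemma spanning_number_le:
  assumes "finite S" "spanning T n \<epsilon> d S"
  shows "spanning_number T n \<epsilon> d \<le> card S"
proof -
  have "card S \<in> card ` {S. finite S \<and> spanning T n \<epsilon> d S}" using assms by simp
  then show ?thesis unfolding spanning_number_def by (rule wellorder_Inf_le1)
qed

lemma spanning_number_pos:
  assumes "compatible_metric d" "\<epsilon> > 0"
  shows "spanning_number T n \<epsilon> d > 0"
proof -
  obtain S where "finite S" "spanning T n \<epsilon> d S" "card S = spanning_number T n \<epsilon> d"
    using spanning_number_attained[OF assms] by blast
  moreover from this have "S \<noteq> {}" by (auto simp: spanning_def)
  ultimately show ?thesis by (metis card_gt_0_iff)
qed

end

section \<open>Mean dimension is at most metric mean dimension\<close>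

text \<open>Union bound: for given \<open>y\<close> and a set of \<open>K\<close> coordinates, at
  most \<open>q ^ (card J - K)\<close> of the \<open>q ^ card J\<close> grid points agree with
  \<open>l y\<close> on that set. There are at most \<open>2 ^ card J\<close> such sets, so
  \<open>less\<close> leaves a grid point that no pair excludes.\<close>

lemma exists_avoiding_grid_point:
  fixes l :: "'y \<Rightarrow> 'j \<Rightarrow> nat" and q K :: nat
  assumes J: "finite J" and Y: "finite Y" and q: "q > 0" and less: "card Y * 2 ^ card J < q ^ K"
  obtains c where "c \<in> J \<rightarrow>\<^sub>E {..<q}" "\<And>y. y \<in> Y \<Longrightarrow> card {j\<in>J. c j = l y j} < K"
proof -
  define G where "G = J \<rightarrow>\<^sub>E {..<q}"
  define Q where "Q = {A. A \<subseteq> J \<and> card A = K}"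
  define bad where "bad y A = {c\<in>G. \<forall>j\<in>A. c j = l y j}" for y A
  have finG: "finite G" and cardG: "card G = q ^ card J"
    using J by (simp_all add: G_def finite_PiE card_PiE)
  have finQ: "finite Q" using J by (simp add: Q_def)
  have cardQ: "card Q \<le> 2 ^ card J"
    using card_mono[of "Pow J" Q] J by (auto simp: Q_def card_Pow)
  have bad: "card (bad y A) \<le> q ^ (card J - K)" if "A \<in> Q" for y A
  proof -
    have A: "A \<subseteq> J" "card A = K" using that by (auto simp: Q_def)
    have "inj_on (\<lambda>c. restrict c (J - A)) (bad y A)"
    proof (rule inj_onI)
      fix c c' assume *: "c \<in> bad y A" "c' \<in> bad y A" "restrict c (J - A) = restrict c' (J - A)"
      have "c j = c' j" if "j \<in> J" for j
        using *(1,2) fun_cong[OF *(3), of j] that by (cases "j \<in> A") (auto simp: bad_def)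
      then show "c = c'" using *(1,2) by (intro PiE_ext[of _ J "\<lambda>_. {..<q}"]) (auto simp: bad_def G_def)
    qed
    moreover have "(\<lambda>c. restrict c (J - A)) ` bad y A \<subseteq> (J - A) \<rightarrow>\<^sub>E {..<q}"
      by (auto simp: bad_def G_def)
    ultimately have "card (bad y A) \<le> card ((J - A) \<rightarrow>\<^sub>E {..<q})"
      using J by (intro card_inj_on_le) (auto simp: finite_PiE)
    also have "\<dots> = q ^ (card J - K)"
      using J A finite_subset[OF A(1) J] by (simp add: card_PiE card_Diff_subset)
    finally show ?thesis .
  qed
  have "card (\<Union>y\<in>Y. \<Union>A\<in>Q. bad y A) < card G"
  proof (cases "K \<le> card J")
    case True
    have "card (\<Union>y\<in>Y. \<Union>A\<in>Q. bad y A) \<le> (\<Sum>y\<in>Y. card (\<Union>A\<in>Q. bad y A))"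
      using Y by (rule card_UN_le)
    also have "\<dots> \<le> (\<Sum>y\<in>Y. \<Sum>A\<in>Q. card (bad y A))" by (intro sum_mono card_UN_le finQ)
    also have "\<dots> \<le> (\<Sum>y\<in>Y. \<Sum>A\<in>Q. q ^ (card J - K))" by (intro sum_mono bad)
    also have "\<dots> = (card Y * card Q) * q ^ (card J - K)" by simp
    also have "\<dots> \<le> (card Y * 2 ^ card J) * q ^ (card J - K)"
      using cardQ by (intro mult_right_mono mult_left_mono) auto
    also have "\<dots> < q ^ K * q ^ (card J - K)" using less q by (intro mult_strict_right_mono) auto
    also have "\<dots> = card G" using True by (simp add: cardG flip: power_add)
    finally show ?thesis .
  next
    case False
    then have "Q = {}" using J card_mono[of J] by (auto simp: Q_def)
    then show ?thesis using q by (simp add: cardG)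
  qed
  then have "\<not> G \<subseteq> (\<Union>y\<in>Y. \<Union>A\<in>Q. bad y A)"
    using card_mono[of "\<Union>y\<in>Y. \<Union>A\<in>Q. bad y A" G] Y finQ finG by (auto simp: bad_def)
  then obtain c where c: "c \<in> G" "\<And>y A. y \<in> Y \<Longrightarrow> A \<in> Q \<Longrightarrow> c \<notin> bad y A" by blast
  have "card {j\<in>J. c j = l y j} < K" if "y \<in> Y" for y
  proof (rule ccontr)
    assume "\<not> ?thesis"
    then obtain A where "A \<subseteq> {j\<in>J. c j = l y j}" "card A = K"
      using obtain_subset_with_card_n[of K "{j\<in>J. c j = l y j}"] by auto
    then have "A \<in> Q" "c \<in> bad y A" using c(1) by (auto simp: Q_def bad_def)
    then show False using c(2) that by blast
  qed
  then show thesis using c(1) that by (auto simp: G_def)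
qed

context compact_dynamics
begin

text \<open>If every point is near few hyperplanes \<open>F j = \<xi> j\<close>, truncating the functions
  \<open>F j - \<xi> j\<close> maps the space to the low-dimensional skeleton of a cube.\<close>

lemma cover_dim_le_skeleton:
  fixes F :: "'j \<Rightarrow> 'a \<Rightarrow> real"
  assumes J: "finite J" and cF: "\<And>j. j \<in> J \<Longrightarrow> continuous_on UNIV (F j)"
    and \<eta>: "\<eta> > 0" and count: "\<And>x. card {j\<in>J. \<bar>F j x - \<xi> j\<bar> < \<eta>} \<le> K"
    and sub: "\<And>s. \<exists>U\<in>\<alpha>. {x. \<forall>j\<in>J. if s j then \<xi> j - \<eta> < F j x else F j x < \<xi> j + \<eta>} \<subseteq> U"
  shows "cover_dim \<alpha> \<le> K"
proof -
  define t where "t j x = (F j x - \<xi> j) / \<eta>" for j x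
  \<comment> \<open>The two functions for \<open>j\<close> form one group. The larger one is 1, and
    both are positive exactly when \<open>F j x\<close> is within \<open>\<eta>\<close> of
    \<open>\<xi> j\<close>, which is what \<open>count\<close> bounds.\<close>
  define r where "r e x = min 1 (1 + (if snd e then t (fst e) x else - t (fst e) x))" for e x
  define E where "E = J \<times> (UNIV :: bool set)"
  have grpE: "fst ` E = J" by (auto simp: E_def)
  have pos: "r (j, b) x > 0 \<longleftrightarrow> (if b then \<xi> j - \<eta> < F j x else F j x < \<xi> j + \<eta>)" for j b x
    using \<eta> by (auto simp: r_def t_def field_simps)
  show ?thesis
  proof (rule cover_dim_le_nerve[where E = E and r = r and grp = fst])
    show "finite E" using J by (simp add: E_def)
    show "continuous_on UNIV (r e)" if "e \<in> E" for e
    proof -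
      have "continuous_on UNIV (t (fst e))"
        unfolding t_def using that \<eta> by (auto intro!: continuous_intros cF simp: E_def)
      then show ?thesis unfolding r_def by (cases "snd e") (auto intro!: continuous_intros)
    qed
    show "r e x \<le> 1" for e x by (simp add: r_def)
    show "\<exists>e\<in>E. fst e = g \<and> r e x = 1" if "g \<in> fst ` E" for g x
    proof (cases "t g x \<ge> 0")
      case True
      then show ?thesis using that by (intro bexI[of _ "(g, True)"]) (auto simp: r_def E_def)
    next
      case False
      then show ?thesis using that by (intro bexI[of _ "(g, False)"]) (auto simp: r_def E_def)
    qed
    show "card {e \<in> E. r e x > 0} \<le> card (fst ` E) + K" for x
    proof -
      let ?N = "{j\<in>J. \<bar>F j x - \<xi> j\<bar> < \<eta>}"
      have "{e \<in> E. r e x > 0} \<subseteq> (\<lambda>j. (j, \<xi> j \<le> F j x)) ` J \<union> (\<lambda>j. (j, \<not> \<xi> j \<le> F j x)) ` ?N"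
      proof
        fix e assume "e \<in> {e \<in> E. r e x > 0}"
        then obtain j b where e: "e = (j, b)" "j \<in> J" "if b then \<xi> j - \<eta> < F j x else F j x < \<xi> j + \<eta>"
          using pos by (cases e) (auto simp: E_def)
        show "e \<in> (\<lambda>j. (j, \<xi> j \<le> F j x)) ` J \<union> (\<lambda>j. (j, \<not> \<xi> j \<le> F j x)) ` ?N"
        proof (cases "b \<longleftrightarrow> \<xi> j \<le> F j x")
          case True
          then have "e = (\<lambda>j. (j, \<xi> j \<le> F j x)) j" using e(1) by simp
          then show ?thesis using e(2) by (intro UnI1 image_eqI)
        next
          case False
          then have "e = (\<lambda>j. (j, \<not> \<xi> j \<le> F j x)) j" "j \<in> ?N"
            using e \<eta> by (auto split: if_splits)
          then show ?thesis by (intro UnI2 image_eqI)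
        qed
      qed
      then have "card {e \<in> E. r e x > 0}
          \<le> card ((\<lambda>j. (j, \<xi> j \<le> F j x)) ` J \<union> (\<lambda>j. (j, \<not> \<xi> j \<le> F j x)) ` ?N)"
        using J by (intro card_mono) auto
      also have "\<dots> \<le> card J + card ?N"
        using J by (intro order_trans[OF card_Un_le] add_mono card_image_le) auto
      finally show ?thesis using count[of x] by (simp add: grpE)
    qed
    show "\<exists>U\<in>\<alpha>. {x. \<forall>e\<in>C. r e x > 0} \<subseteq> U" if C: "C \<subseteq> E" "fst ` C = fst ` E" for C
    proof -
      have "\<exists>b. (j, b) \<in> C" if "j \<in> J" for j
      proof -
        have "j \<in> fst ` C" using that C(2) grpE by simp
        then show ?thesis by force
      qed
      then obtain s where s: "\<And>j. j \<in> J \<Longrightarrow> (j, s j) \<in> C" by metis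
      obtain U where U: "U \<in> \<alpha>" "{x. \<forall>j\<in>J. if s j then \<xi> j - \<eta> < F j x else F j x < \<xi> j + \<eta>} \<subseteq> U"
        using sub[of s] by blast
      have "{x. \<forall>e\<in>C. r e x > 0} \<subseteq> {x. \<forall>j\<in>J. if s j then \<xi> j - \<eta> < F j x else F j x < \<xi> j + \<eta>}"
      proof (intro subsetI CollectI ballI)
        fix x j assume "x \<in> {x. \<forall>e\<in>C. r e x > 0}" "j \<in> J"
        then have "r (j, s j) x > 0" using s by blast
        then show "if s j then \<xi> j - \<eta> < F j x else F j x < \<xi> j + \<eta>" by (simp only: pos)
      qed
      also note U(2)
      finally show ?thesis using U(1) by blast
    qed
  qed
qed

text \<open>The orbit map records the bumps of \<open>\<alpha>\<close> at the times below
  \<open>N\<close>. Points of a spanning set represent all others up to a quarter of the grid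
  spacing in each coordinate, so a grid point sharing fewer than \<open>K\<close> coordinates with
  each representative has every point of the space near fewer than \<open>K\<close> of its
  hyperplanes. Pushing away from that grid point is the skeleton bound. The factor
  \<open>2 ^ (card \<alpha> * N)\<close> is the price of the union bound over sets of
  coordinates.\<close>

lemma cover_dim_iterated_le_spanning:
  assumes d: "compatible_metric d" and \<alpha>: "\<alpha> \<in> finite_open_covers"
  obtains C where "C > 0" "\<And>\<epsilon> q N K. \<lbrakk>\<epsilon> > 0; q > 0; 4 * real (q + 1) * C * \<epsilon> \<le> 1;
      spanning_number T N \<epsilon> d * 2 ^ (card \<alpha> * N) < q ^ K\<rbrakk>
    \<Longrightarrow> cover_dim (iterated_cover T \<alpha> N) \<le> K"
proof -
  have fin: "finite \<alpha>" and "\<And>U. U \<in> \<alpha> \<Longrightarrow> open U" "(\<Union>U\<in>\<alpha>. U) = UNIV"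
    using \<alpha> by (auto simp: finite_open_covers_def)
  note foc = this
  obtain f C where C: "C > 0" and f: "bumps \<alpha> (\<lambda>U. U) f"
    and lip: "\<And>U x y. U \<in> \<alpha> \<Longrightarrow> \<bar>f U x - f U y\<bar> \<le> C * d x y"
  proof (rule lipschitz_bumps[OF d compact, of \<alpha> "\<lambda>U. U"])
    fix f C assume "C > (0::real)" "bumps \<alpha> (\<lambda>U. U) f" "\<And>U x y. U \<in> \<alpha> \<Longrightarrow> \<bar>f U x - f U y\<bar> \<le> C * d x y"
    then show thesis by (rule that)
  qed (use foc in simp_all)
  note f = bumpsD[OF f]
  have "cover_dim (iterated_cover T \<alpha> N) \<le> K"
    if \<epsilon>: "\<epsilon> > 0" and q: "q > 0" and fine: "4 * real (q + 1) * C * \<epsilon> \<le> 1"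
      and less: "spanning_number T N \<epsilon> d * 2 ^ (card \<alpha> * N) < q ^ K" for \<epsilon> q N K
  proof -
    obtain S where S: "finite S" "spanning T N \<epsilon> d S" "card S = spanning_number T N \<epsilon> d"
      using spanning_number_attained[OF d \<epsilon>] by blast
    define J where "J = \<alpha> \<times> {..<N}"
    define F where "F j x = f (fst j) ((T ^^ snd j) x)" for j x
    \<comment> \<open>The \<open>q\<close> grid values are the interior multiples of
      \<open>h\<close>. They keep distance \<open>h\<close> from 0 and from 1, so that the tolerance
      \<open>\<eta>\<close> stays inside the unit interval.\<close>
    define h where "h = 1 / real (q + 1)"
    define \<eta> where "\<eta> = h / 4"
    define pt where "pt i = (real i + 1) * h" for i :: nat
    have h: "h > 0" "\<eta> > 0" by (simp_all add: h_def \<eta>_def)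
    have C\<epsilon>: "C * \<epsilon> \<le> \<eta>" using fine by (simp add: \<eta>_def h_def field_simps)
    define l where "l y j = (SOME i. \<bar>F j y - pt i\<bar> < h / 2)" for y j
    have l: "i = l y j" if "\<bar>F j y - pt i\<bar> < h / 2" for i y j
    proof -
      have "\<bar>F j y - pt (l y j)\<bar> < h / 2" unfolding l_def by (rule someI) (rule that)
      then have "\<bar>pt i - pt (l y j)\<bar> < h" using that by linarith
      moreover have "pt i - pt (l y j) = (real i - real (l y j)) * h" by (simp add: pt_def algebra_simps)
      ultimately have "\<bar>real i - real (l y j)\<bar> < 1" using h by (simp add: abs_mult)
      then show ?thesis by linarith
    qed
    have "finite J" "card J = card \<alpha> * N" using fin by (simp_all add: J_def card_cartesian_product)
    then obtain c where c: "c \<in> J \<rightarrow>\<^sub>E {..<q}" "\<And>y. y \<in> S \<Longrightarrow> card {j\<in>J. c j = l y j} < K"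
      using exists_avoiding_grid_point[of J S q K l] S(1,3) q less by auto
    have range: "0 < pt (c j) - \<eta>" "pt (c j) + \<eta> < 1" if "j \<in> J" for j
    proof -
      have "real (c j) + 1 \<le> real q" using c(1) that by (auto dest!: PiE_mem simp flip: of_nat_Suc)
      then have "pt (c j) \<le> real q * h" unfolding pt_def using h by (intro mult_right_mono) auto
      also have "\<dots> = 1 - h" by (simp add: h_def field_simps)
      finally show "pt (c j) + \<eta> < 1" using h by (simp add: \<eta>_def)
      have "1 * h \<le> pt (c j)" unfolding pt_def using h by (intro mult_right_mono) auto
      then show "0 < pt (c j) - \<eta>" using h by (simp add: \<eta>_def)
    qed
    show ?thesis
    proof (rule cover_dim_le_skeleton[where F = F and J = J and \<eta> = \<eta> and \<xi> = "\<lambda>j. pt (c j)"])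
      show "finite J" "\<eta> > 0" by fact+
      show "continuous_on UNIV (F j)" if "j \<in> J" for j
      proof -
        have "continuous_on UNIV (f (fst j))" using f(1) that by (auto simp: J_def)
        then have "continuous_on UNIV (f (fst j) \<circ> (T ^^ snd j))"
          using continuous_on_subset by (intro continuous_on_compose continuous_funpow) blast
        then show ?thesis by (simp add: F_def comp_def)
      qed
      show "card {j\<in>J. \<bar>F j x - pt (c j)\<bar> < \<eta>} \<le> K" for x
      proof -
        obtain y where y: "y \<in> S" "\<And>k. k < N \<Longrightarrow> d ((T ^^ k) x) ((T ^^ k) y) < \<epsilon>"
          using S(2) by (auto simp: spanning_def)
        have "c j = l y j" if "j \<in> J" "\<bar>F j x - pt (c j)\<bar> < \<eta>" for j
        proof (rule l)
          have "\<bar>F j x - F j y\<bar> \<le> C * d ((T ^^ snd j) x) ((T ^^ snd j) y)"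
            unfolding F_def using that(1) by (intro lip) (auto simp: J_def)
          also have "\<dots> \<le> C * \<epsilon>" using C y(2)[of "snd j"] that(1) by (auto simp: J_def)
          finally show "\<bar>F j y - pt (c j)\<bar> < h / 2" using that(2) C\<epsilon> unfolding \<eta>_def by linarith
        qed
        then have "card {j\<in>J. \<bar>F j x - pt (c j)\<bar> < \<eta>} \<le> card {j\<in>J. c j = l y j}"
          using \<open>finite J\<close> by (intro card_mono) auto
        then show ?thesis using c(2)[OF y(1)] by simp
      qed
      show "\<exists>U\<in>iterated_cover T \<alpha> N.
          {x. \<forall>j\<in>J. if s j then pt (c j) - \<eta> < F j x else F j x < pt (c j) + \<eta>} \<subseteq> U"
        (is "\<exists>U\<in>_. ?A \<subseteq> U") for s
      proof (rule subset_iterated_coverI)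
        fix k assume k: "k < N"
        show "\<exists>U\<in>\<alpha>. ?A \<subseteq> (T ^^ k) -` U"
        proof (cases "\<exists>U\<in>\<alpha>. s (U, k)")
          case True
          then obtain U where U: "U \<in> \<alpha>" "s (U, k)" by blast
          then have J: "(U, k) \<in> J" using k by (simp add: J_def)
          have "(T ^^ k) x \<in> U" if "x \<in> ?A" for x
          proof -
            have "pt (c (U, k)) - \<eta> < F (U, k) x" using that J U(2) by auto
            then have "f U ((T ^^ k) x) > 0" using range(1)[OF J] by (simp add: F_def)
            then show ?thesis using f(4)[OF U(1)] by blast
          qed
          then show ?thesis using U(1) by (intro bexI[of _ U]) auto
        next
          case False
          \<comment> \<open>With all signs negative at time \<open>k\<close>, every bump would be
            below 1 at \<open>(T ^^ k) x\<close>. So \<open>?A\<close> is empty and fits into any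
            member of \<open>\<alpha>\<close>.\<close>
          have "x \<notin> ?A" for x
          proof
            assume x: "x \<in> ?A"
            obtain U where U: "U \<in> \<alpha>" "f U ((T ^^ k) x) = 1" using f(5) by blast
            then have J: "(U, k) \<in> J" using k by (simp add: J_def)
            have "F (U, k) x < pt (c (U, k)) + \<eta>" using x J False U(1) by auto
            then show False using range(2)[OF J] U(2) by (simp add: F_def)
          qed
          then show ?thesis using f(5) by blast
        qed
      qed
    qed
  qed
  with C show thesis by (rule that)
qed

text \<open>Taking the least \<open>K\<close> allowed by the previous bound and dividing by
  \<open>N\<close> gives the inequality up to \<open>ln (real q) / real N\<close>. As
  \<open>cover_mdim \<alpha>\<close> is an infimum over block lengths, this holds at each
  \<open>N\<close> separately, and the error vanishes in the upper limit.\<close>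

lemma cover_mdim_le_scale_entropy:
  assumes d: "compatible_metric d" and \<alpha>: "\<alpha> \<in> finite_open_covers"
  obtains C where "C > 0" "\<And>\<epsilon> q. \<lbrakk>\<epsilon> > 0; q \<ge> 2; 4 * real (q + 1) * C * \<epsilon> \<le> 1\<rbrakk>
    \<Longrightarrow> ereal (cover_mdim \<alpha> * ln (real q) - real (card \<alpha>) * ln 2) \<le> scale_entropy T \<epsilon> d"
proof -
  obtain C where C: "C > 0" "\<And>\<epsilon> q N K. \<lbrakk>\<epsilon> > 0; q > 0; 4 * real (q + 1) * C * \<epsilon> \<le> 1;
      spanning_number T N \<epsilon> d * 2 ^ (card \<alpha> * N) < q ^ K\<rbrakk>
    \<Longrightarrow> cover_dim (iterated_cover T \<alpha> N) \<le> K"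
    using cover_dim_iterated_le_spanning[OF d \<alpha>] by blast
  have "ereal (cover_mdim \<alpha> * ln (real q) - real (card \<alpha>) * ln 2) \<le> scale_entropy T \<epsilon> d"
    if \<epsilon>: "\<epsilon> > 0" and q: "q \<ge> 2" and fine: "4 * real (q + 1) * C * \<epsilon> \<le> 1" for \<epsilon> q
  proof -
    have lnq: "ln (real q) > 0" using q by simp
    let ?A = "\<lambda>n. real (spanning_number T n \<epsilon> d)"
    have step: "cover_mdim \<alpha> * ln (real q) - real (card \<alpha>) * ln 2 - ln (real q) / real N \<le> ln (?A N) / real N"
      if N: "N \<ge> 1" for N
    proof -
      have A: "?A N > 0" using spanning_number_pos[OF d \<epsilon>] by simp
      define z where "z = (ln (?A N) + real (card \<alpha> * N) * ln 2) / ln (real q)"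
      have "z \<ge> 0"
        unfolding z_def using A lnq by (intro divide_nonneg_pos add_nonneg_nonneg mult_nonneg_nonneg) auto
      \<comment> \<open>The added 1 makes the comparison with \<open>q ^ K\<close> strict.\<close>
      define K where "K = nat \<lfloor>z\<rfloor> + 1"
      have K: "z < real K" "real K \<le> z + 1" using \<open>z \<ge> 0\<close> by (auto simp: K_def) linarith+
      have "ln (?A N * 2 ^ (card \<alpha> * N)) = ln (?A N) + real (card \<alpha> * N) * ln 2"
        using A by (simp add: ln_mult ln_realpow)
      also have "\<dots> = z * ln (real q)" using lnq by (simp add: z_def)
      also have "\<dots> < real K * ln (real q)" using K lnq by simp
      also have "\<dots> = ln (real q ^ K)" using q by (simp add: ln_realpow)
      finally have "?A N * 2 ^ (card \<alpha> * N) < real q ^ K" using A q by (subst (asm) ln_less_cancel_iff) auto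
      then have "real (spanning_number T N \<epsilon> d * 2 ^ (card \<alpha> * N)) < real (q ^ K)" by simp
      then have "spanning_number T N \<epsilon> d * 2 ^ (card \<alpha> * N) < q ^ K" by (simp only: of_nat_less_iff)
      then have "real (cover_dim (iterated_cover T \<alpha> N)) \<le> z + 1"
        using C(2)[OF \<epsilon> _ fine, of N K] q K(2) by simp
      then have "cover_mdim \<alpha> \<le> (z + 1) / real N"
        using cover_mdim_le[OF \<alpha> N] N by (smt (verit) divide_right_mono of_nat_0_le_iff)
      then have "cover_mdim \<alpha> * ln (real q) \<le> (z + 1) / real N * ln (real q)"
        using lnq by (intro mult_right_mono) auto
      also have "\<dots> = ln (?A N) / real N + real (card \<alpha>) * ln 2 + ln (real q) / real N"
        using lnq N by (simp add: z_def field_simps)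
      finally show ?thesis by simp
    qed
    have "(\<lambda>N. cover_mdim \<alpha> * ln (real q) - real (card \<alpha>) * ln 2 - ln (real q) / real N)
        \<longlonglongrightarrow> cover_mdim \<alpha> * ln (real q) - real (card \<alpha>) * ln 2 - 0"
      by (intro tendsto_diff tendsto_const lim_const_over_n)
    then have eq: "limsup (\<lambda>N. ereal (cover_mdim \<alpha> * ln (real q) - real (card \<alpha>) * ln 2 - ln (real q) / real N))
        = ereal (cover_mdim \<alpha> * ln (real q) - real (card \<alpha>) * ln 2)"
      by (intro lim_imp_Limsup) auto
    have "limsup (\<lambda>N. ereal (cover_mdim \<alpha> * ln (real q) - real (card \<alpha>) * ln 2 - ln (real q) / real N))
        \<le> scale_entropy T \<epsilon> d"
      unfolding scale_entropy_def
      using step by (intro Limsup_mono eventually_sequentiallyI[of 1]) simp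
    then show ?thesis unfolding eq .
  qed
  with C(1) show thesis by (rule that)
qed

text \<open>Choosing \<open>q\<close> comparable to 1/\<epsilon> makes \<open>ln (real q)\<close>
  equal to |ln \<epsilon>| up to a constant. That constant and the term
  \<open>real (card \<alpha>) * ln 2\<close> disappear after division by |ln \<epsilon>|.\<close>

lemma mdim_le_metric_mdim:
  assumes d: "compatible_metric d"
  shows "mdim T \<le> metric_mdim T d"
  unfolding mdim_eq
proof (rule SUP_least)
  fix \<alpha> :: "'a set set" assume \<alpha>: "\<alpha> \<in> finite_open_covers"
  obtain C where C: "C > 0" "\<And>\<epsilon> q. \<lbrakk>\<epsilon> > 0; q \<ge> 2; 4 * real (q + 1) * C * \<epsilon> \<le> 1\<rbrakk>
    \<Longrightarrow> ereal (cover_mdim \<alpha> * ln (real q) - real (card \<alpha>) * ln 2) \<le> scale_entropy T \<epsilon> d"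
    using cover_mdim_le_scale_entropy[OF d \<alpha>] by blast
  define c where "c = cover_mdim \<alpha> * ln (8 * C) + real (card \<alpha>) * ln 2"
  have bound: "ereal (cover_mdim \<alpha> - c / \<bar>ln \<epsilon>\<bar>) \<le> scale_entropy T \<epsilon> d / ereal \<bar>ln \<epsilon>\<bar>"
    if \<epsilon>: "\<epsilon> > 0" "\<epsilon> < 1" "16 * C * \<epsilon> < 1" for \<epsilon>
  proof -
    \<comment> \<open>The largest \<open>q\<close> meeting the fineness condition. Since 16 C
      \<epsilon> < 1, losing at most 2 from 1 / (4 C \<epsilon>) > 4 leaves at least half of it,
      which explains the 8 in \<open>c\<close>.\<close>
    define q where "q = nat \<lfloor>1 / (4 * C * \<epsilon>)\<rfloor> - 1"
    have C\<epsilon>: "C * \<epsilon> > 0" "C * \<epsilon> < 1 / 16" using C(1) \<epsilon> by auto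
    have large: "1 / (4 * C * \<epsilon>) > 4" using C\<epsilon> C(1) \<epsilon> by (simp add: field_simps)
    then have q: "real q + 1 \<le> 1 / (4 * C * \<epsilon>)" "real q > 1 / (4 * C * \<epsilon>) - 2" "q \<ge> 2"
      unfolding q_def by (linarith | simp)+
    have "4 * real (q + 1) * C * \<epsilon> \<le> 1" using q(1) C(1) \<epsilon> by (simp add: field_simps)
    from C(2)[OF \<epsilon>(1) q(3) this]
    have 1: "ereal (cover_mdim \<alpha> * ln (real q) - real (card \<alpha>) * ln 2) \<le> scale_entropy T \<epsilon> d" .
    have "1 / (4 * C * \<epsilon>) = 2 * (1 / (8 * C * \<epsilon>))" by simp
    then have "1 / (8 * C * \<epsilon>) \<le> real q" using q(2) large by linarith
    then have "ln (1 / (8 * C * \<epsilon>)) \<le> ln (real q)" using C(1) \<epsilon> by (intro ln_mono) auto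
    moreover have "ln (1 / (8 * C * \<epsilon>)) = \<bar>ln \<epsilon>\<bar> - ln (8 * C)"
      using C(1) \<epsilon> by (simp add: ln_div ln_mult)
    ultimately have "cover_mdim \<alpha> * (\<bar>ln \<epsilon>\<bar> - ln (8 * C)) \<le> cover_mdim \<alpha> * ln (real q)"
      using cover_mdim_nonneg[OF \<alpha>] by (intro mult_left_mono) auto
    then have "cover_mdim \<alpha> * \<bar>ln \<epsilon>\<bar> - c \<le> cover_mdim \<alpha> * ln (real q) - real (card \<alpha>) * ln 2"
      by (simp add: c_def algebra_simps)
    then have 2: "ereal (cover_mdim \<alpha> * \<bar>ln \<epsilon>\<bar> - c) \<le> scale_entropy T \<epsilon> d"
      using 1 by (meson ereal_less_eq(3) order_trans)
    have lnpos: "\<bar>ln \<epsilon>\<bar> > 0" using \<epsilon> by simp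
    have "ereal (cover_mdim \<alpha> * \<bar>ln \<epsilon>\<bar> - c) / ereal \<bar>ln \<epsilon>\<bar> \<le> scale_entropy T \<epsilon> d / ereal \<bar>ln \<epsilon>\<bar>"
      using 2 lnpos by (intro ereal_divide_right_mono) auto
    moreover have "ereal (cover_mdim \<alpha> * \<bar>ln \<epsilon>\<bar> - c) / ereal \<bar>ln \<epsilon>\<bar> = ereal (cover_mdim \<alpha> - c / \<bar>ln \<epsilon>\<bar>)"
      using lnpos by (simp add: field_simps)
    ultimately show ?thesis by simp
  qed
  have "filterlim (\<lambda>\<epsilon>::real. \<bar>ln \<epsilon>\<bar>) at_top (at_right 0)"
    using filterlim_compose[OF filterlim_abs_real filterlim_compose[OF filterlim_uminus_at_top_at_bot ln_at_0]]
    by simp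
  then have "((\<lambda>\<epsilon>. cover_mdim \<alpha> - c / \<bar>ln \<epsilon>\<bar>) \<longlongrightarrow> cover_mdim \<alpha> - 0) (at_right 0)"
    by (intro tendsto_diff tendsto_const real_tendsto_divide_at_top[OF tendsto_const])
  then have "Liminf (at_right 0) (\<lambda>\<epsilon>. ereal (cover_mdim \<alpha> - c / \<bar>ln \<epsilon>\<bar>)) = ereal (cover_mdim \<alpha>)"
    by (intro lim_imp_Liminf) auto
  moreover have "Liminf (at_right 0) (\<lambda>\<epsilon>. ereal (cover_mdim \<alpha> - c / \<bar>ln \<epsilon>\<bar>)) \<le> metric_mdim T d"
    unfolding metric_mdim_def
  proof (rule Liminf_mono)
    have "\<forall>\<^sub>F \<epsilon> in at_right (0::real). \<epsilon> \<in> {0<..<min 1 (1 / (16 * C))}"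
      using C(1) by (intro eventually_at_right_real) auto
    then show "\<forall>\<^sub>F \<epsilon> in at_right 0. ereal (cover_mdim \<alpha> - c / \<bar>ln \<epsilon>\<bar>) \<le> scale_entropy T \<epsilon> d / ereal \<bar>ln \<epsilon>\<bar>"
      by eventually_elim (rule bound, use C(1) in \<open>auto simp: field_simps\<close>)
  qed
  ultimately show "ereal (cover_mdim \<alpha>) \<le> metric_mdim T d" by simp
qed

end

section \<open>Thresholds and markers\<close>

text \<open>For \<open>a\<close> < \<open>M\<close> these are \<open>M\<close> levels spaced by 1 /
  (M + 1), and \<open>halfgap\<close> is half the spacing, so the tolerance windows are disjoint and
  lie inside the open unit interval. The levels decrease in \<open>a\<close>, so that acceptance
  gets easier as a marker ages.\<close>

definition threshold :: "nat \<Rightarrow> nat \<Rightarrow> real" where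
  "threshold M a = (real M - real a) / (real M + 1)"

definition halfgap :: "nat \<Rightarrow> real" where
  "halfgap M = 1 / (2 * (real M + 1))"

lemma halfgap_pos: "halfgap M > 0"
  by (simp add: halfgap_def)

lemma threshold_antimono: "a \<le> b \<Longrightarrow> threshold M b \<le> threshold M a"
  by (simp add: threshold_def divide_right_mono)

lemma threshold_range:
  assumes "a < M"
  shows "0 < threshold M a - halfgap M" "threshold M a + halfgap M < 1"
proof -
  have "threshold M a = (2 * (real M - real a)) / (2 * (real M + 1))"
    unfolding threshold_def by (rule mult_divide_mult_cancel_left[symmetric]) simp
  then have "threshold M a - halfgap M = (2 * (real M - real a) - 1) / (2 * (real M + 1))"
    "threshold M a + halfgap M = (2 * (real M - real a) + 1) / (2 * (real M + 1))"
    by (simp_all only: halfgap_def diff_divide_distrib add_divide_distrib)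
  moreover have "real a + 1 \<le> real M" using assms by simp
  ultimately show "0 < threshold M a - halfgap M" "threshold M a + halfgap M < 1"
    by (simp_all add: divide_less_eq)
qed

lemma threshold_tie_unique:
  assumes "\<bar>u - threshold M a\<bar> < halfgap M" "\<bar>u - threshold M b\<bar> < halfgap M"
  shows "a = b"
proof -
  have "\<bar>threshold M a - threshold M b\<bar> < 2 * halfgap M" using assms by linarith
  moreover have "threshold M a - threshold M b = (real b - real a) / (real M + 1)"
    by (simp add: threshold_def diff_divide_distrib[symmetric])
  ultimately have "\<bar>real b - real a\<bar> < 1" by (simp add: halfgap_def abs_div divide_simps)
  then show ?thesis by linarith
qed

text \<open>The windows are disjoint, so each \<open>e\<close> is tied at one level at most, and a
  tied value is fractional. Ties at all levels together therefore cost no more than the fractional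
  values counted once.\<close>

lemma sum_card_threshold_ties:
  assumes E: "finite E" and R: "R \<subseteq> {..<M}"
  shows "(\<Sum>r\<in>R. card {e\<in>E. \<bar>u e - threshold M r\<bar> < halfgap M}) \<le> card {e\<in>E. 0 < u e \<and> u e < 1}"
proof -
  let ?T = "\<lambda>r. {e\<in>E. \<bar>u e - threshold M r\<bar> < halfgap M}"
  have "finite R" using R finite_subset by blast
  then have "(\<Sum>r\<in>R. card (?T r)) = card (\<Union>r\<in>R. ?T r)"
    using E threshold_tie_unique by (intro card_UN_disjoint[symmetric]) auto
  also have "\<dots> \<le> card {e\<in>E. 0 < u e \<and> u e < 1}"
  proof (rule card_mono)
    show "(\<Union>r\<in>R. ?T r) \<subseteq> {e\<in>E. 0 < u e \<and> u e < 1}"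
    proof clarify
      fix r e assume "r \<in> R" "e \<in> E" and *: "\<bar>u e - threshold M r\<bar> < halfgap M"
      then have "r < M" using R by auto
      from threshold_range[OF this] * show "0 < u e \<and> u e < 1" by linarith
    qed
  qed (use E in simp)
  finally show ?thesis .
qed

text \<open>Time \<open>t\<close> is served by the marker at time \<open>s\<close>, of strength \<open>u s\<close>, up to the tolerance
  \<open>halfgap m\<close>. The required strength depends on the age \<open>t - s\<close>, so that a marker is ambiguous
  at one age only.\<close>

definition active :: "nat \<Rightarrow> (nat \<Rightarrow> real) \<Rightarrow> nat \<Rightarrow> nat \<Rightarrow> bool" where
  "active m u t s \<longleftrightarrow> s \<le> t \<and> t < s + m \<and> u s > threshold m (t - s) - halfgap m \<and>
     (\<forall>s'. s < s' \<and> s' \<le> t \<longrightarrow> u s' < threshold m (t - s') + halfgap m)"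

text \<open>As time passes the level for \<open>s\<close> falls, so \<open>s\<close> stays accepted,
  while a later marker still within tolerance at \<open>t3\<close> was so at \<open>t2\<close>. The
  service of a marker is thus an interval of times, which can be cut into blocks with only two
  incomplete ones.\<close>

lemma active_convex:
  assumes "active m u t1 s" "active m u t3 s" "t1 \<le> t2" "t2 \<le> t3"
  shows "active m u t2 s"
  unfolding active_def
proof (intro conjI allI impI)
  show "s \<le> t2" "t2 < s + m" using assms by (auto simp: active_def)
  have "threshold m (t2 - s) \<le> threshold m (t1 - s)" using assms by (intro threshold_antimono) auto
  then show "u s > threshold m (t2 - s) - halfgap m" using assms(1) by (auto simp: active_def)
  fix s' assume s': "s < s' \<and> s' \<le> t2"
  then have "u s' < threshold m (t3 - s') + halfgap m" using assms by (auto simp: active_def)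
  also have "threshold m (t3 - s') \<le> threshold m (t2 - s')" using assms by (intro threshold_antimono) auto
  finally show "u s' < threshold m (t2 - s') + halfgap m" by simp
qed

lemma active_pos: "active m u t s \<Longrightarrow> u s > 0"
proof -
  assume act: "active m u t s"
  then have "t - s < m" by (auto simp: active_def)
  from threshold_range(1)[OF this] act show "u s > 0" by (simp add: active_def)
qed

section \<open>Counting over blocks of time\<close>

lemma card_separated:
  fixes P :: "nat set"
  assumes "L > 0" "P \<subseteq> {..<n}" and sep: "\<And>s s'. s \<in> P \<Longrightarrow> s' \<in> P \<Longrightarrow> s < s' \<Longrightarrow> s + L \<le> s'"
  shows "real (card P) \<le> real n / real L + 1"
proof -
  have "inj_on (\<lambda>s. s div L) P"
  proof (rule linorder_inj_onI')
    fix s s' assume "s \<in> P" "s' \<in> P" "s < s'"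
    then have "(s + L) div L \<le> s' div L" using sep by (intro div_le_mono) auto
    then show "s div L \<noteq> s' div L" using assms(1) by simp
  qed
  then have "card P = card ((\<lambda>s. s div L) ` P)" by (simp add: card_image)
  also have "\<dots> \<le> card {..n div L}"
    using assms(2) by (intro card_mono) (auto intro!: div_le_mono)
  finally have "real (card P) \<le> real (n div L) + 1" by simp
  also have "real (n div L) \<le> real n / real L" by (rule of_nat_div_le_of_nat)
  finally show ?thesis by simp
qed

text \<open>Blocks of length \<open>N\<close> are counted from \<open>s\<close>, and the interval
  \<open>I\<close> meets at most \<open>card I / N + 2\<close> of them. Each costs the number of its
  times in \<open>I\<close> plus \<open>d\<close>; incomplete blocks are covered because
  \<open>block\<close> is assumed for every subset \<open>R\<close>.\<close>

lemma sum_blocks_le: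
  fixes c :: "nat \<Rightarrow> nat \<Rightarrow> nat"
  assumes N: "N > 0" and block: "\<And>\<tau> R. R \<subseteq> {..<N} \<Longrightarrow> (\<Sum>r\<in>R. c r \<tau>) \<le> card R + d"
    and I: "finite I" "\<And>t. t \<in> I \<Longrightarrow> s \<le> t"
    and convex: "\<And>t1 t2 t3. t1 \<in> I \<Longrightarrow> t3 \<in> I \<Longrightarrow> t1 \<le> t2 \<Longrightarrow> t2 \<le> t3 \<Longrightarrow> t2 \<in> I"
  shows "real (\<Sum>t\<in>I. c ((t - s) mod N) (t - (t - s) mod N))
       \<le> real (card I) * (1 + real d / real N) + 2 * real d"
proof (cases "I = {}")
  case False
  define b where "b t = (t - s) div N" for t
  define Ik where "Ik k = {t\<in>I. b t = k}" for k
  have decomp: "t - s = b t * N + (t - s) mod N" for t by (simp add: b_def)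
  have inner: "(\<Sum>t\<in>Ik k. c ((t - s) mod N) (t - (t - s) mod N)) \<le> card (Ik k) + d" for k
  proof -
    have inj: "inj_on (\<lambda>t. (t - s) mod N) (Ik k)"
    proof (rule inj_onI)
      fix t t' assume *: "t \<in> Ik k" "t' \<in> Ik k" "(t - s) mod N = (t' - s) mod N"
      then have "t - s = t' - s" using decomp[of t] decomp[of t'] by (simp add: Ik_def)
      moreover have "s \<le> t" "s \<le> t'" using * I(2) by (auto simp: Ik_def)
      ultimately show "t = t'" by linarith
    qed
    have "t - (t - s) mod N = s + k * N" if "t \<in> Ik k" for t
    proof -
      have "b t = k" "s \<le> t" using that I(2) by (auto simp: Ik_def)
      then show ?thesis using decomp[of t] by simp
    qed
    then have "(\<Sum>t\<in>Ik k. c ((t - s) mod N) (t - (t - s) mod N)) = (\<Sum>t\<in>Ik k. c ((t - s) mod N) (s + k * N))"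
      by (intro sum.cong) auto
    also have "\<dots> = (\<Sum>r\<in>(\<lambda>t. (t - s) mod N) ` Ik k. c r (s + k * N))"
      using sum.reindex[OF inj, of "\<lambda>r. c r (s + k * N)"] by simp
    also have "\<dots> \<le> card ((\<lambda>t. (t - s) mod N) ` Ik k) + d" using N by (intro block) auto
    also have "\<dots> = card (Ik k) + d" using card_image[OF inj] by simp
    finally show ?thesis .
  qed
  have "(\<Sum>t\<in>I. c ((t - s) mod N) (t - (t - s) mod N))
      = (\<Sum>k\<in>b ` I. \<Sum>t\<in>Ik k. c ((t - s) mod N) (t - (t - s) mod N))"
    unfolding Ik_def using I(1) by (rule sum.image_gen)
  also have "\<dots> \<le> (\<Sum>k\<in>b ` I. card (Ik k) + d)" by (intro sum_mono inner)
  also have "\<dots> = (\<Sum>k\<in>b ` I. card (Ik k)) + card (b ` I) * d" by (simp add: sum.distrib)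
  also have "(\<Sum>k\<in>b ` I. card (Ik k)) = card I"
    unfolding Ik_def card_eq_sum using I(1) by (rule sum.image_gen[symmetric])
  finally have total: "(\<Sum>t\<in>I. c ((t - s) mod N) (t - (t - s) mod N)) \<le> card I + card (b ` I) * d" .
  define lo hi where "lo = Min I" and "hi = Max I"
  have lohi: "lo \<in> I" "hi \<in> I" "lo \<le> hi" "s \<le> lo" using I False by (auto simp: lo_def hi_def)
  have I_eq: "I = {lo..hi}"
  proof (intro antisym subsetI)
    fix t assume "t \<in> I"
    then show "t \<in> {lo..hi}" using I(1) by (simp add: lo_def hi_def)
  next
    fix t assume "t \<in> {lo..hi}"
    then show "t \<in> I" by (intro convex[OF lohi(1,2)]) simp_all
  qed
  then have cardI: "real (card I) = real hi - real lo + 1" using lohi by simp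
  have "b ` I \<subseteq> {b lo..b hi}" unfolding b_def I_eq by (auto intro!: div_le_mono diff_le_mono)
  then have "card (b ` I) \<le> card {b lo..b hi}" by (intro card_mono) auto
  moreover have "b lo \<le> b hi" using lohi by (simp add: b_def div_le_mono diff_le_mono)
  ultimately have "real (card (b ` I)) \<le> real (b hi) - real (b lo) + 1" by simp
  moreover have "real (b hi) \<le> real (hi - s) / real N" unfolding b_def by (rule of_nat_div_le_of_nat)
  moreover have "real (lo - s) / real N \<le> real (b lo) + 1"
  proof -
    have "lo - s \<le> (b lo + 1) * N" using decomp[of lo] mod_less_divisor[OF N, of "lo - s"] by simp
    then have "real (lo - s) \<le> (real (b lo) + 1) * real N" by (metis of_nat_1 of_nat_add of_nat_le_iff of_nat_mult)
    then show ?thesis using N by (simp add: divide_simps)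
  qed
  ultimately have "real (card (b ` I)) \<le> real (hi - s) / real N - real (lo - s) / real N + 2" by linarith
  also have "real (hi - s) / real N - real (lo - s) / real N = (real hi - real lo) / real N"
    using lohi by (simp add: of_nat_diff diff_divide_distrib)
  also have "\<dots> \<le> real (card I) / real N" using cardI by (simp add: divide_right_mono)
  finally have "real (card (b ` I)) * real d \<le> (real (card I) / real N + 2) * real d"
    by (intro mult_right_mono) auto
  moreover have "real (\<Sum>t\<in>I. c ((t - s) mod N) (t - (t - s) mod N)) \<le> real (card I) + real (card (b ` I)) * real d"
    using total by (metis of_nat_add of_nat_le_iff of_nat_mult)
  ultimately show ?thesis by (simp add: algebra_simps)
qed simp

text \<open>Of the markers serving a given time, the earliest is free. Every other one lies below
  the upper tolerance because the earliest serves, and above the lower one because it serves itself: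
  it is tied at its current age. A marker is tied at one age only, so the excess over all times is
  at most the number of markers.\<close>

lemma sum_card_active_le:
  assumes P: "P = {s\<in>{..<m+n}. u s > 0}"
  shows "(\<Sum>t\<in>{m..<m+n}. card {s. active m u t s}) \<le> n + card P"
proof -
  have finP: "finite P" by (simp add: P)
  define tie where "tie t = {s\<in>P. s \<le> t \<and> \<bar>u s - threshold m (t - s)\<bar> < halfgap m}" for t
  have fin_act: "finite {s. active m u t s}" for t
    by (rule finite_subset[of _ "{..t}"]) (auto simp: active_def)
  have "card {s. active m u t s} \<le> Suc (card (tie t))" if t: "t \<in> {m..<m+n}" for t
  proof (cases "{s. active m u t s} = {}")
    case False
    define s0 where "s0 = Min {s. active m u t s}"
    have s0: "active m u t s0" "\<And>s. active m u t s \<Longrightarrow> s0 \<le> s"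
      using Min_in[OF fin_act False] Min_le[OF fin_act] by (auto simp: s0_def)
    have "{s. active m u t s} \<subseteq> insert s0 (tie t)"
    proof
      fix s assume "s \<in> {s. active m u t s}"
      then have s: "active m u t s" by simp
      show "s \<in> insert s0 (tie t)"
      proof (cases "s = s0")
        case False
        then have "s0 < s" using s0(2)[OF s] by simp
        then have "u s < threshold m (t - s) + halfgap m" using s0(1) s by (auto simp: active_def)
        moreover have "u s > threshold m (t - s) - halfgap m" "s \<le> t" using s by (auto simp: active_def)
        ultimately show ?thesis using active_pos[OF s] t by (auto simp: tie_def P)
      qed simp
    qed
    then have "card {s. active m u t s} \<le> card (insert s0 (tie t))"
      using finP by (intro card_mono) (auto simp: tie_def)
    also have "\<dots> \<le> Suc (card (tie t))" by (rule card_insert_le_m1) auto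
    finally show ?thesis .
  qed simp
  then have "(\<Sum>t\<in>{m..<m+n}. card {s. active m u t s}) \<le> (\<Sum>t\<in>{m..<m+n}. Suc (card (tie t)))"
    by (rule sum_mono)
  also have "\<dots> = n + (\<Sum>t\<in>{m..<m+n}. card (tie t))" by (simp add: sum.distrib Suc_eq_plus1 del: One_nat_def)
  also have "(\<Sum>t\<in>{m..<m+n}. card (tie t)) = card (SIGMA t:{m..<m+n}. tie t)"
    using finP by (subst card_SigmaI) (auto simp: tie_def)
  also have "\<dots> \<le> card P"
  proof (rule card_inj_on_le[of snd])
    show "inj_on snd (SIGMA t:{m..<m+n}. tie t)"
    proof (rule inj_onI)
      fix p q assume *: "p \<in> (SIGMA t:{m..<m+n}. tie t)" "q \<in> (SIGMA t:{m..<m+n}. tie t)" "snd p = snd q"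
      obtain t s t' where pq: "p = (t, s)" "q = (t', s)" using *(3) by (metis surjective_pairing)
      then have "s \<le> t" "s \<le> t'" "t - s = t' - s"
        using * threshold_tie_unique[of "u s" m "t - s" "t' - s"] by (auto simp: tie_def)
      then show "p = q" using pq by auto
    qed
  qed (auto simp: tie_def finP)
  finally show ?thesis by simp
qed

text \<open>Summing over markers instead of times reduces this to blocks within single intervals of
  service. Per marker the loss is one tie, charged at the rate \<open>1 + real d / real N\<close>,
  and \<open>2 * real d\<close> for incomplete blocks; separation bounds the number of
  markers.\<close>

lemma marker_block_count:
  fixes c :: "nat \<Rightarrow> nat \<Rightarrow> nat"
  assumes N: "N > 0" and L: "L > 0"
    and sep: "\<And>s s'. u s > 0 \<Longrightarrow> u s' > 0 \<Longrightarrow> s < s' \<Longrightarrow> s + L \<le> s'"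
    and block: "\<And>\<tau> R. R \<subseteq> {..<N} \<Longrightarrow> (\<Sum>r\<in>R. c r \<tau>) \<le> card R + d"
  shows "real (\<Sum>t\<in>{m..<m+n}. \<Sum>s\<in>{s. active m u t s}. c ((t - s) mod N) (t - (t - s) mod N))
     \<le> real n * (1 + real d / real N) + (real (m + n) / real L + 1) * (1 + real d / real N + 2 * real d)"
proof -
  define P where "P = {s\<in>{..<m+n}. u s > 0}"
  define I where "I s = {t\<in>{m..<m+n}. active m u t s}" for s
  define f where "f t s = c ((t - s) mod N) (t - (t - s) mod N)" for t s
  have finP: "finite P" by (simp add: P_def)
  have act: "{s. active m u t s} = {s\<in>P. active m u t s}" if "t \<in> {m..<m+n}" for t
    using that active_pos[of m u t] by (auto simp: P_def active_def)
  have swap: "(\<Sum>t\<in>{m..<m+n}. \<Sum>s\<in>{s. active m u t s}. g t s) = (\<Sum>s\<in>P. \<Sum>t\<in>I s. g t s)"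
    for g :: "nat \<Rightarrow> nat \<Rightarrow> nat"
  proof -
    have "(\<Sum>t\<in>{m..<m+n}. \<Sum>s\<in>{s. active m u t s}. g t s)
        = (\<Sum>t\<in>{m..<m+n}. \<Sum>s\<in>{s\<in>P. active m u t s}. g t s)"
      by (intro sum.cong refl act)
    also have "\<dots> = (\<Sum>s\<in>P. \<Sum>t\<in>I s. g t s)"
      unfolding I_def using finP by (intro sum.swap_restrict) auto
    finally show ?thesis .
  qed
  have "real (\<Sum>s\<in>P. \<Sum>t\<in>I s. f t s) = (\<Sum>s\<in>P. real (\<Sum>t\<in>I s. f t s))" by simp
  also have "\<dots> \<le> (\<Sum>s\<in>P. real (card (I s)) * (1 + real d / real N) + 2 * real d)"
    unfolding f_def
  proof (intro sum_mono sum_blocks_le[OF N block])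
    fix s t1 t2 t3 assume t: "t1 \<in> I s" "t3 \<in> I s" "t1 \<le> t2" "t2 \<le> t3"
    then have "active m u t2 s" using active_convex[of m u t1 s t3 t2] by (simp add: I_def)
    then show "t2 \<in> I s" using t by (simp add: I_def)
  qed (auto simp: I_def active_def)
  also have "\<dots> = (\<Sum>s\<in>P. real (card (I s))) * (1 + real d / real N) + real (card P) * (2 * real d)"
    by (simp add: sum.distrib sum_distrib_right)
  also have "(\<Sum>s\<in>P. real (card (I s))) = real (\<Sum>t\<in>{m..<m+n}. card {s. active m u t s})"
    using swap[of "\<lambda>_ _. 1"] by simp
  also have "\<dots> \<le> real n + real (card P)"
    using sum_card_active_le[OF P_def] by (metis of_nat_add of_nat_le_iff)
  finally have "real (\<Sum>s\<in>P. \<Sum>t\<in>I s. f t s)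
      \<le> (real n + real (card P)) * (1 + real d / real N) + real (card P) * (2 * real d)"
    by (simp add: mult_right_mono)
  also have "\<dots> = real n * (1 + real d / real N) + real (card P) * (1 + real d / real N + 2 * real d)"
    by (simp add: algebra_simps)
  also have "\<dots> \<le> real n * (1 + real d / real N)
      + (real (m + n) / real L + 1) * (1 + real d / real N + 2 * real d)"
    using card_separated[OF L, of P "m + n"] sep by (intro add_left_mono mult_right_mono) (auto simp: P_def)
  finally show ?thesis using swap[of f] by (simp add: f_def)
qed

section \<open>Covers of small mean order\<close>

context compact_dynamics
begin

text \<open>With the bumps of \<open>\<gamma>\<close> listed in some order, \<open>V r e\<close>
  says that \<open>e\<close> is the first to pass level \<open>r\<close>, up to the tolerance that
  makes the condition open. All members except one at a given level are ties, and ties are shared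
  among the levels. Arbitrary \<open>R\<close> is allowed so that blocks may be cut short.\<close>

lemma low_order_covers:
  assumes \<alpha>: "\<alpha> \<in> finite_open_covers"
  obtains V :: "nat \<Rightarrow> nat \<Rightarrow> 'a set" and M where
    "\<And>r e. r < N \<Longrightarrow> e < M \<Longrightarrow> open (V r e)"
    "\<And>r e. r < N \<Longrightarrow> e < M \<Longrightarrow> \<exists>U\<in>\<alpha>. V r e \<subseteq> (T ^^ r) -` U"
    "\<And>r y. r < N \<Longrightarrow> \<exists>e<M. y \<in> V r e"
    "\<And>y R. R \<subseteq> {..<N} \<Longrightarrow>
      (\<Sum>r\<in>R. card {e\<in>{..<M}. y \<in> V r e}) \<le> card R + cover_dim (iterated_cover T \<alpha> N)"
proof -
  obtain \<gamma> where \<gamma>: "\<gamma> \<in> finite_open_covers" "finer_cover \<gamma> (iterated_cover T \<alpha> N)"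
    "\<And>x. card {U\<in>\<gamma>. x \<in> U} \<le> Suc (cover_dim (iterated_cover T \<alpha> N))"
    using cover_dim_attained[OF iterated_cover_open_cover[OF \<alpha>, of N]] by blast
  obtain p where "bumps \<gamma> (\<lambda>V. V) p" by (rule cover_bumps[OF compact \<gamma>(1)])
  note p = bumpsD[OF this]
  have fin: "finite \<gamma>" using \<gamma>(1) by (simp add: finite_open_covers_def)
  define M where "M = card \<gamma>"
  obtain G where G: "bij_betw G {..<M} \<gamma>"
    using ex_bij_betw_nat_finite[OF fin] by (auto simp: M_def lessThan_atLeast0)
  have G\<gamma>: "G e \<in> \<gamma>" if "e < M" for e using bij_betwE[OF G] that by simp
  define u where "u e = p (G e)" for e
  define V where "V r e = {y. u e y > threshold N r - halfgap N \<and>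
      (\<forall>e'<e. u e' y < threshold N r + halfgap N)}" for r e
  have one: "\<exists>e<M. u e y = 1" for y
  proof -
    obtain U where "U \<in> \<gamma>" "p U y = 1" using p(5) by blast
    moreover from this obtain e where "e < M" "G e = U" using G by (auto simp: bij_betw_def)
    ultimately show ?thesis by (auto simp: u_def)
  qed
  have upos: "y \<in> G e" if "e < M" "u e y > 0" for e y
    using p(4)[OF G\<gamma>[OF that(1)]] that(2) by (simp add: u_def)
  have "open (V r e)" if "e < M" for r e
  proof -
    have c: "continuous_on UNIV (u e')" if "e' \<le> e" for e'
      unfolding u_def using that \<open>e < M\<close> by (intro p(1) G\<gamma>) auto
    have "V r e = {y. u e y > threshold N r - halfgap N} \<inter>
        (\<Inter>e'\<in>{..<e}. {y. u e' y < threshold N r + halfgap N})" by (auto simp: V_def)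
    also have "open \<dots>"
      by (intro open_Int open_INT ballI open_Collect_less continuous_on_const c) auto
    finally show ?thesis .
  qed
  moreover have "\<exists>U\<in>\<alpha>. V r e \<subseteq> (T ^^ r) -` U" if r: "r < N" and e: "e < M" for r e
  proof -
    have sub: "V r e \<subseteq> G e"
      using threshold_range(1)[OF r] by (auto simp: V_def intro!: upos[OF e])
    obtain W where W: "W \<in> iterated_cover T \<alpha> N" "G e \<subseteq> W"
      using \<gamma>(2) G\<gamma>[OF e] by (auto simp: finer_cover_def)
    obtain U where "U \<in> \<alpha>" "W \<subseteq> (T ^^ r) -` U" using iterated_coverD[OF W(1) r] by blast
    with order_trans[OF order_trans[OF sub W(2)]] show ?thesis by blast
  qed
  moreover have "\<exists>e<M. y \<in> V r e" if "r < N" for r y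
  proof -
    define e where "e = (LEAST e. u e y > threshold N r - halfgap N)"
    obtain e1 where e1: "e1 < M" "u e1 y = 1" using one by blast
    have *: "u e1 y > threshold N r - halfgap N"
      using e1 threshold_range(2)[OF that] halfgap_pos[of N] by linarith
    have e: "u e y > threshold N r - halfgap N" unfolding e_def
      by (rule LeastI[where P = "\<lambda>e. u e y > threshold N r - halfgap N", OF *])
    have "e \<le> e1" unfolding e_def
      by (rule Least_le[where P = "\<lambda>e. u e y > threshold N r - halfgap N", OF *])
    moreover have "u e' y < threshold N r + halfgap N" if "e' < e" for e'
      using not_less_Least[of e' "\<lambda>e. u e y > threshold N r - halfgap N"] that halfgap_pos[of N]
      by (simp add: e_def)
    ultimately show ?thesis using e e1(1) by (intro exI[of _ e]) (auto simp: V_def)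
  qed
  moreover have "(\<Sum>r\<in>R. card {e\<in>{..<M}. y \<in> V r e}) \<le> card R + cover_dim (iterated_cover T \<alpha> N)"
    if R: "R \<subseteq> {..<N}" for y R
  proof -
    let ?tie = "\<lambda>r. {e\<in>{..<M}. \<bar>u e y - threshold N r\<bar> < halfgap N}"
    have "card {e\<in>{..<M}. y \<in> V r e} \<le> Suc (card (?tie r))" if r: "r \<in> R" for r
    proof -
      have "r < N" using r R by auto
      \<comment> \<open>The first bump definitely above the level excludes all later ones; an
        earlier one can only belong to the cover within the tolerance.\<close>
      define e0 where "e0 = (LEAST e. u e y \<ge> threshold N r + halfgap N)"
      obtain e1 where e1: "e1 < M" "u e1 y = 1" using one by blast
      have "u e1 y \<ge> threshold N r + halfgap N" using e1 threshold_range(2)[OF \<open>r < N\<close>] by simp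
      then have e0: "u e0 y \<ge> threshold N r + halfgap N" unfolding e0_def
        by (rule LeastI[where P = "\<lambda>e. u e y \<ge> threshold N r + halfgap N"])
      have "{e\<in>{..<M}. y \<in> V r e} \<subseteq> insert e0 (?tie r)"
      proof
        fix e assume e: "e \<in> {e\<in>{..<M}. y \<in> V r e}"
        show "e \<in> insert e0 (?tie r)"
        proof (cases "e = e0")
          case False
          have "\<not> e0 < e" using e e0 by (auto simp: V_def)
          then have "\<not> u e y \<ge> threshold N r + halfgap N"
            using False not_less_Least[of e "\<lambda>e. u e y \<ge> threshold N r + halfgap N"] by (simp add: e0_def)
          then show ?thesis using e by (auto simp: V_def)
        qed simp
      qed
      then have "card {e\<in>{..<M}. y \<in> V r e} \<le> card (insert e0 (?tie r))" by (intro card_mono) auto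
      also have "\<dots> \<le> Suc (card (?tie r))" by (rule card_insert_le_m1) auto
      finally show ?thesis .
    qed
    then have "(\<Sum>r\<in>R. card {e\<in>{..<M}. y \<in> V r e}) \<le> (\<Sum>r\<in>R. Suc (card (?tie r)))" by (rule sum_mono)
    also have "\<dots> = card R + (\<Sum>r\<in>R. card (?tie r))" by (simp add: sum.distrib Suc_eq_plus1 del: One_nat_def)
    also have "(\<Sum>r\<in>R. card (?tie r)) \<le> card {e\<in>{..<M}. 0 < u e y \<and> u e y < 1}"
      by (rule sum_card_threshold_ties[OF _ R]) simp
    also have "card {e\<in>{..<M}. 0 < u e y \<and> u e y < 1} \<le> cover_dim (iterated_cover T \<alpha> N)"
    proof -
      obtain e1 where e1: "e1 < M" "u e1 y = 1" using one by blast
      \<comment> \<open>A bump with value 1 is never tied, and leaving it out turns the multiplicity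
        of \<open>\<gamma>\<close> into its order.\<close>
      let ?A = "{e\<in>{..<M}. 0 < u e y \<and> u e y < 1}"
      have "G ` insert e1 ?A \<subseteq> {U\<in>\<gamma>. y \<in> U}" using e1 upos G\<gamma> by auto
      moreover have "inj_on G (insert e1 ?A)"
        using e1(1) by (intro inj_on_subset[OF bij_betw_imp_inj_on[OF G]]) auto
      ultimately have "card (insert e1 ?A) \<le> card {U\<in>\<gamma>. y \<in> U}"
        using fin by (intro card_inj_on_le) auto
      also have "\<dots> \<le> Suc (cover_dim (iterated_cover T \<alpha> N))" by (rule \<gamma>(3))
      finally show ?thesis using e1(2) by simp
    qed
    finally show ?thesis by simp
  qed
  ultimately show thesis by (rule that[of M V])
qed

end

locale compact_system = compact_dynamics T for T :: "'a::metric_space \<Rightarrow> 'a" +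
  fixes S :: "'a \<Rightarrow> 'a"
  assumes inverse: "S (T x) = x" "T (S x) = x" and cont_inverse: "continuous_on UNIV S"
begin

sublocale backward: compact_dynamics S
  by unfold_locales (rule compact, rule cont_inverse)

lemma funpow_inverse: "(S ^^ n) ((T ^^ n) x) = x" "(T ^^ n) ((S ^^ n) x) = x"
proof -
  have "(f ^^ n) ((g ^^ n) x) = x" if inv: "\<And>x. f (g x) = x" for f g :: "'a \<Rightarrow> 'a"
  proof (induction n)
    case (Suc n)
    have "(f ^^ Suc n) ((g ^^ Suc n) x) = (f ^^ n) (f (g ((g ^^ n) x)))" by (simp add: funpow_swap1)
    then show ?case using Suc inv by simp
  qed simp
  then show "(S ^^ n) ((T ^^ n) x) = x" "(T ^^ n) ((S ^^ n) x) = x" using inverse by simp_all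
qed

lemma funpow_inverse_diff: "a \<le> t \<Longrightarrow> (S ^^ a) ((T ^^ t) x) = (T ^^ (t - a)) x"
  using funpow_inverse(1)[of a "(T ^^ (t - a)) x"] funpow_add[of a "t - a" T] by simp

text \<open>Bumps for the cover by the images of an open marker set \<open>F\<close> are pulled back
  to \<open>F\<close> and added up. The sum is supported in \<open>F\<close>, whence the separation,
  and it reaches 1 at \<open>(S ^^ a) x\<close> whenever the bump of age \<open>a\<close> is 1 at
  \<open>x\<close>.\<close>

lemma marker_function:
  assumes "marker_property T"
  obtains w :: "'a \<Rightarrow> real" and m where "continuous_on UNIV w"
    "\<And>x i. \<lbrakk>w x > 0; 1 \<le> i; i < L\<rbrakk> \<Longrightarrow> \<not> w ((T ^^ i) x) > 0" "\<And>x. \<exists>a<m. w ((S ^^ a) x) = 1"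
proof -
  obtain F m where F: "open F" "\<And>i. i \<in> {1..<L} \<Longrightarrow> F \<inter> (T ^^ i) ` F = {}"
    "(\<Union>i\<in>{1..m}. (T ^^ i) ` F) = UNIV"
    using assms unfolding marker_property_def marker_def by metis
  have cover: "\<exists>a<m. (S ^^ a) x \<in> F" for x
  proof -
    \<comment> \<open>The covering images start at the first iterate while ages start at 0; passing
      to \<open>T x\<close> absorbs the shift.\<close>
    have "T x \<in> (\<Union>i\<in>{1..m}. (T ^^ i) ` F)" unfolding F(3) by simp
    then obtain i z where i: "i \<in> {1..m}" "z \<in> F" "T x = (T ^^ i) z" by auto
    then have "(S ^^ i) (T x) = z" by (simp add: funpow_inverse)
    moreover obtain k where k: "i = Suc k" using i(1) by (cases i) auto
    ultimately have "(S ^^ k) x = z" by (simp only: funpow_Suc_right o_apply inverse)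
    then show ?thesis using i k by (intro exI[of _ k]) auto
  qed
  obtain p where p: "bumps {..<m} (\<lambda>a. (S ^^ a) -` F) p"
  proof (rule bumps_exist[OF compact])
    show "finite {..<m}" by simp
    show "open ((S ^^ a) -` F)" for a by (rule open_vimage[OF F(1) backward.continuous_funpow])
    show "(\<Union>a<m. (S ^^ a) -` F) = UNIV" using cover by fastforce
  qed (rule that)
  note p = bumpsD[OF p]
  define w where "w x = min 1 (\<Sum>a<m. p a ((T ^^ a) x))" for x
  have nonneg: "0 \<le> p a x" if "a < m" for a x using p(2) that by simp
  have "continuous_on UNIV (\<lambda>x. p a ((T ^^ a) x))" if "a < m" for a
    using continuous_on_compose2[OF p(1) continuous_funpow] that by auto
  then have "continuous_on UNIV w" unfolding w_def by (intro continuous_intros) auto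
  moreover have inF: "x \<in> F" if "w x > 0" for x
  proof -
    have "(\<Sum>a<m. p a ((T ^^ a) x)) > 0" using that by (simp add: w_def)
    then have "\<not> (\<forall>a\<in>{..<m}. p a ((T ^^ a) x) \<le> 0)" using sum_nonpos[of "{..<m}" "\<lambda>a. p a ((T ^^ a) x)"] by force
    then obtain a where a: "a < m" "p a ((T ^^ a) x) > 0" by (auto simp: not_le)
    then show ?thesis using p(4)[of a "(T ^^ a) x"] by (simp add: funpow_inverse)
  qed
  then have "\<not> w ((T ^^ i) x) > 0" if "w x > 0" "1 \<le> i" "i < L" for x i
    using F(2)[of i] that by fastforce
  moreover have "\<exists>a<m. w ((S ^^ a) x) = 1" for x
  proof -
    obtain a where a: "a < m" "p a x = 1" using p(5) by auto
    have "p a ((T ^^ a) ((S ^^ a) x)) \<le> (\<Sum>b<m. p b ((T ^^ b) ((S ^^ a) x)))"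
      using a(1) nonneg by (intro member_le_sum) auto
    then show ?thesis using a by (auto simp: w_def funpow_inverse)
  qed
  ultimately show thesis by (rule that)
qed

text \<open>\<open>A a\<close> is the set of points whose serving marker may be \<open>a\<close>
  steps old, that is, \<open>active\<close> read backwards along the orbit. The current block then
  began \<open>a mod N\<close> steps ago, and \<open>W\<close> cuts by the cover that
  \<open>low_order_covers\<close> assigns to this position in the block. Multiplicities along an
  orbit are the double sum in \<open>marker_block_count\<close>.\<close>

lemma small_mean_order_cover:
  assumes marker: "marker_property T" and \<alpha>: "\<alpha> \<in> finite_open_covers" and D: "cover_mdim \<alpha> < D"
  obtains W :: "nat \<times> nat \<Rightarrow> 'a set" and I C where "finite I" "\<And>j. j \<in> I \<Longrightarrow> open (W j)"
    "(\<Union>j\<in>I. W j) = UNIV" "\<And>j. j \<in> I \<Longrightarrow> \<exists>U\<in>\<alpha>. W j \<subseteq> U"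
    "\<And>x n. real (\<Sum>i<n. card {j\<in>I. (T ^^ i) x \<in> W j}) \<le> real n * (1 + D) + C"
proof -
  define D' where "D' = (cover_mdim \<alpha> + D) / 2"
  have D': "cover_mdim \<alpha> < D'" "D' < D" using D by (auto simp: D'_def)
  obtain N where N: "N > 0" "real (cover_dim (iterated_cover T \<alpha> N)) / real N < D'"
    using eventually_conj[OF order_tendstoD(2)[OF tendsto_cover_mdim[OF \<alpha>] D'(1)] eventually_gt_at_top[of 0]]
    by (auto simp: eventually_sequentially)
  define d where "d = cover_dim (iterated_cover T \<alpha> N)"
  obtain V :: "nat \<Rightarrow> nat \<Rightarrow> 'a set" and M where V:
    "\<And>r e. r < N \<Longrightarrow> e < M \<Longrightarrow> open (V r e)"
    "\<And>r e. r < N \<Longrightarrow> e < M \<Longrightarrow> \<exists>U\<in>\<alpha>. V r e \<subseteq> (T ^^ r) -` U"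
    "\<And>r y. r < N \<Longrightarrow> \<exists>e<M. y \<in> V r e"
    "\<And>y R. R \<subseteq> {..<N} \<Longrightarrow> (\<Sum>r\<in>R. card {e\<in>{..<M}. y \<in> V r e}) \<le> card R + d"
  proof (rule low_order_covers[OF \<alpha>, of N, folded d_def], goal_cases)
    case (1 V M)
    from 1(2-) show ?case by (rule 1(1))
  qed
  \<comment> \<open>The loss charged to one marker. \<open>L\<close> is taken so large that this
    loss, spread over the gap between markers, fits between \<open>D'\<close> and
    \<open>D\<close>.\<close>
  define Q where "Q = 1 + real d / real N + 2 * real d"
  have "Q > 0" by (auto simp: Q_def intro!: add_pos_nonneg)
  obtain L :: nat where L: "real L > Q / (D - D')" using reals_Archimedean2 by blast
  then have "L > 0" using \<open>Q > 0\<close> D'(2) by (smt (verit) divide_pos_pos of_nat_0_less_iff)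
  have QL: "Q / real L < D - D'" using L \<open>L > 0\<close> D'(2) by (simp add: field_simps)
  obtain w :: "'a \<Rightarrow> real" and m where w: "continuous_on UNIV w"
    "\<And>x i. \<lbrakk>w x > 0; 1 \<le> i; i < L\<rbrakk> \<Longrightarrow> \<not> w ((T ^^ i) x) > 0" "\<And>x. \<exists>a<m. w ((S ^^ a) x) = 1"
  proof (rule marker_function[OF marker, where L = L], goal_cases)
    case (1 w m)
    from 1(2-) show ?case by (rule 1(1))
  qed
  define A where "A a = {x. w ((S ^^ a) x) > threshold m a - halfgap m \<and>
    (\<forall>b<a. w ((S ^^ b) x) < threshold m b + halfgap m)}" for a
  define W where "W j = A (fst j) \<inter> (S ^^ (fst j mod N)) -` V (fst j mod N) (snd j)" for j
  define I where "I = {..<m} \<times> {..<M}"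
  have cw: "continuous_on UNIV (\<lambda>x. w ((S ^^ a) x))" for a
    using continuous_on_compose2[OF w(1) backward.continuous_funpow] by auto
  have openA: "open (A a)" for a
  proof -
    have "A a = {x. w ((S ^^ a) x) > threshold m a - halfgap m} \<inter>
      (\<Inter>b\<in>{..<a}. {x. w ((S ^^ b) x) < threshold m b + halfgap m})" by (auto simp: A_def)
    also have "open \<dots>"
      by (intro open_Int open_INT ballI open_Collect_less continuous_on_const cw) auto
    finally show ?thesis .
  qed
  have "finite I" by (simp add: I_def)
  moreover have "open (W j)" if "j \<in> I" for j
    unfolding W_def using that N(1)
    by (intro open_Int openA open_vimage backward.continuous_funpow V(1)) (auto simp: I_def)
  moreover have "\<exists>j\<in>I. x \<in> W j" for x
  proof -
    define a where "a = (LEAST a. w ((S ^^ a) x) > threshold m a - halfgap m)"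
    obtain a1 where a1: "a1 < m" "w ((S ^^ a1) x) = 1" using w(3) by blast
    have *: "w ((S ^^ a1) x) > threshold m a1 - halfgap m"
      using a1 threshold_range(2)[OF a1(1)] halfgap_pos[of m] by linarith
    have a: "w ((S ^^ a) x) > threshold m a - halfgap m" unfolding a_def
      by (rule LeastI[where P = "\<lambda>a. w ((S ^^ a) x) > threshold m a - halfgap m", OF *])
    have "a \<le> a1" unfolding a_def
      by (rule Least_le[where P = "\<lambda>a. w ((S ^^ a) x) > threshold m a - halfgap m", OF *])
    moreover have "w ((S ^^ b) x) < threshold m b + halfgap m" if "b < a" for b
      using not_less_Least[of b "\<lambda>a. w ((S ^^ a) x) > threshold m a - halfgap m"] that halfgap_pos[of m]
      by (simp add: a_def)
    ultimately have "x \<in> A a" "a < m" using a a1(1) by (auto simp: A_def)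
    moreover obtain e where "e < M" "(S ^^ (a mod N)) x \<in> V (a mod N) e"
      using V(3)[of "a mod N" "(S ^^ (a mod N)) x"] N(1) by auto
    ultimately show ?thesis by (intro bexI[of _ "(a, e)"]) (auto simp: I_def W_def)
  qed
  then have "(\<Union>j\<in>I. W j) = UNIV" by blast
  moreover have "\<exists>U\<in>\<alpha>. W j \<subseteq> U" if j: "j \<in> I" for j
  proof -
    obtain U where U: "U \<in> \<alpha>" "V (fst j mod N) (snd j) \<subseteq> (T ^^ (fst j mod N)) -` U"
      using V(2)[of "fst j mod N" "snd j"] j N(1) by (auto simp: I_def)
    have "x \<in> U" if "x \<in> W j" for x
    proof -
      have "(S ^^ (fst j mod N)) x \<in> (T ^^ (fst j mod N)) -` U" using that U(2) by (auto simp: W_def)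
      then show ?thesis by (simp add: funpow_inverse)
    qed
    then show ?thesis using U(1) by blast
  qed
  moreover have "real (\<Sum>i<n. card {j\<in>I. (T ^^ i) x \<in> W j}) \<le> real n * (1 + D) + (real m / real L + 1) * Q"
    for x n
  proof -
    \<comment> \<open>Time starts \<open>m\<close> steps before \<open>x\<close>. Markers serve only
      at ages below \<open>m\<close>, so from time \<open>m\<close> on all markers in service have a
      nonnegative time.\<close>
    define z where "z = (S ^^ m) x"
    define u where "u s = w ((T ^^ s) z)" for s
    define c where "c r \<tau> = card {e\<in>{..<M}. (T ^^ \<tau>) z \<in> V r e}" for r \<tau>
    have count: "card {j\<in>I. (T ^^ t) z \<in> W j}
        = (\<Sum>s\<in>{s. active m u t s}. c ((t - s) mod N) (t - (t - s) mod N))" if t: "t \<ge> m" for t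
    proof -
      have A: "(T ^^ t) z \<in> A a \<longleftrightarrow> active m u t (t - a)" if a: "a < m" for a
      proof -
        have "(\<forall>b<a. w ((S ^^ b) ((T ^^ t) z)) < threshold m b + halfgap m)
            \<longleftrightarrow> (\<forall>s'. t - a < s' \<and> s' \<le> t \<longrightarrow> u s' < threshold m (t - s') + halfgap m)" (is "?l \<longleftrightarrow> ?r")
        proof
          assume ?l
          show ?r
          proof (intro allI impI)
            fix s' assume s': "t - a < s' \<and> s' \<le> t"
            then have "t - s' < a" "t - (t - s') = s'" using a t by auto
            then show "u s' < threshold m (t - s') + halfgap m"
              using \<open>?l\<close> funpow_inverse_diff[of "t - s'" t z] by (auto simp: u_def)
          qed
        next
          assume ?r
          show ?l
          proof (intro allI impI)
            fix b assume b: "b < a"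
            then have "t - a < t - b \<and> t - b \<le> t" "t - (t - b) = b" using a t by auto
            then show "w ((S ^^ b) ((T ^^ t) z)) < threshold m b + halfgap m"
              using \<open>?r\<close> funpow_inverse_diff[of b t z] a t b by (metis less_imp_le_nat less_le_trans u_def)
          qed
        qed
        then show ?thesis
          using a t by (auto simp: A_def active_def funpow_inverse_diff u_def)
      qed
      have "{j\<in>I. (T ^^ t) z \<in> W j} = (SIGMA a:{a\<in>{..<m}. active m u t (t - a)}.
          {e\<in>{..<M}. (T ^^ (t - a mod N)) z \<in> V (a mod N) e})"
      proof -
        have "(S ^^ (a mod N)) ((T ^^ t) z) = (T ^^ (t - a mod N)) z" if "a < m" for a
          using that t mod_less_eq_dividend[of a N] by (intro funpow_inverse_diff) linarith
        then show ?thesis using A by (auto simp: I_def W_def)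
      qed
      then have "card {j\<in>I. (T ^^ t) z \<in> W j}
          = (\<Sum>a\<in>{a\<in>{..<m}. active m u t (t - a)}. c (a mod N) (t - a mod N))"
        by (simp add: card_SigmaI c_def)
      also have "\<dots> = (\<Sum>s\<in>{s. active m u t s}. c ((t - s) mod N) (t - (t - s) mod N))"
        by (rule sum.reindex_bij_witness[where i = "\<lambda>s. t - s" and j = "\<lambda>a. t - a"])
           (use t in \<open>auto simp: active_def\<close>)
      finally show ?thesis .
    qed
    have "(\<Sum>i<n. card {j\<in>I. (T ^^ i) x \<in> W j}) = (\<Sum>t\<in>{m..<m+n}. card {j\<in>I. (T ^^ t) z \<in> W j})"
    proof (rule sum.reindex_bij_witness[where i = "\<lambda>t. t - m" and j = "\<lambda>i. i + m"])
      fix i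
      have "(T ^^ (i + m)) z = (T ^^ i) x" by (simp add: z_def funpow_add funpow_inverse)
      then show "card {j\<in>I. (T ^^ (i + m)) z \<in> W j} = card {j\<in>I. (T ^^ i) x \<in> W j}" by simp
    qed auto
    also have "\<dots> = (\<Sum>t\<in>{m..<m+n}. \<Sum>s\<in>{s. active m u t s}. c ((t - s) mod N) (t - (t - s) mod N))"
      by (intro sum.cong refl count) simp
    also have "real \<dots> \<le> real n * (1 + real d / real N)
        + (real (m + n) / real L + 1) * (1 + real d / real N + 2 * real d)"
    proof (rule marker_block_count[OF N(1) \<open>L > 0\<close>])
      fix s s' assume s: "u s > 0" "u s' > 0" "s < s'"
      have "(T ^^ (s' - s)) ((T ^^ s) z) = (T ^^ s') z"
        using s(3) funpow_add[of "s' - s" s T] by simp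
      then have "w ((T ^^ (s' - s)) ((T ^^ s) z)) > 0" "w ((T ^^ s) z) > 0" using s by (simp_all add: u_def)
      moreover have "1 \<le> s' - s" using s(3) by simp
      ultimately have "\<not> s' - s < L" using w(2) by blast
      then show "s + L \<le> s'" using s(3) by linarith
    next
      show "(\<Sum>r\<in>R. c r \<tau>) \<le> card R + d" if "R \<subseteq> {..<N}" for \<tau> R
        using V(4)[OF that] by (simp add: c_def)
    qed
    also have "\<dots> = real n * (1 + real d / real N) + real n * (Q / real L) + (real m / real L + 1) * Q"
      unfolding Q_def[symmetric] by (simp add: add_divide_distrib algebra_simps)
    also have "\<dots> \<le> real n * (1 + D') + real n * (D - D') + (real m / real L + 1) * Q"
      using N(2) QL by (intro add_mono mult_left_mono) (auto simp: d_def)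
    also have "\<dots> = real n * (1 + D) + (real m / real L + 1) * Q" by (simp add: algebra_simps)
    finally show ?thesis .
  qed
  ultimately show thesis by (rule that)
qed

end

section \<open>Spanning sets and pseudometrics\<close>

text \<open>There are at most \<open>3 ^ card J\<close> patterns of minimal, maximal and
  intermediate entries. A code with a known pattern is determined by its intermediate entries, of
  which there are at most \<open>R\<close>.\<close>

lemma card_codes_le:
  assumes J: "finite J"
  shows "card {f \<in> J \<rightarrow>\<^sub>E {..q}. card {j\<in>J. f j \<noteq> 0 \<and> f j \<noteq> q} \<le> R} \<le> 3 ^ card J * (q + 1) ^ R"
    (is "card ?F \<le> _")
proof -
  define kind where "kind k = (if k = 0 then 0 else if k = q then 1 else (2::nat))" for k
  define P where "P = J \<rightarrow>\<^sub>E {..<3::nat}"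
  define G where "G t = {f\<in>?F. restrict (kind \<circ> f) J = t}" for t
  have card_G: "card (G t) \<le> (q + 1) ^ R" for t
  proof (cases "G t = {}")
    case False
    define A where "A = {j\<in>J. t j = 2}"
    have kind: "kind (f j) = t j" if "f \<in> G t" "j \<in> J" for f j
      using that by (auto simp: G_def)
    have AR: "card A \<le> R"
    proof -
      obtain f where f: "f \<in> G t" using False by blast
      then have "A = {j\<in>J. f j \<noteq> 0 \<and> f j \<noteq> q}"
        using kind[OF f] by (force simp: A_def kind_def split: if_splits)
      then show ?thesis using f by (simp add: G_def)
    qed
    have "inj_on (\<lambda>f. restrict f A) (G t)"
    proof (rule inj_onI)
      fix f g assume *: "f \<in> G t" "g \<in> G t" "restrict f A = restrict g A"
      have "f j = g j" if j: "j \<in> J" for j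
      proof (cases "j \<in> A")
        case True
        then show ?thesis using fun_cong[OF *(3), of j] by simp
      next
        case False
        then show ?thesis using kind[OF *(1) j] kind[OF *(2) j] j by (auto simp: A_def kind_def split: if_splits)
      qed
      then show "f = g" using *(1,2) by (intro PiE_ext[of _ J "\<lambda>_. {..q}"]) (auto simp: G_def)
    qed
    moreover have "(\<lambda>f. restrict f A) ` G t \<subseteq> A \<rightarrow>\<^sub>E {..q}"
    proof (rule image_subsetI)
      fix f assume "f \<in> G t"
      then have "f \<in> J \<rightarrow>\<^sub>E {..q}" by (simp add: G_def)
      then have "f j \<in> {..q}" if "j \<in> A" for j using that by (auto simp: A_def dest: PiE_mem)
      then show "restrict f A \<in> A \<rightarrow>\<^sub>E {..q}" by simp
    qed
    ultimately have "card (G t) \<le> card (A \<rightarrow>\<^sub>E {..q})"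
      using J by (intro card_inj_on_le) (auto simp: A_def finite_PiE)
    also have "\<dots> = (q + 1) ^ card A" using J by (simp add: card_PiE A_def)
    also have "\<dots> \<le> (q + 1) ^ R" using AR by (intro power_increasing) auto
    finally show ?thesis .
  qed simp
  have "?F \<subseteq> (\<Union>t\<in>P. G t)"
  proof
    fix f assume "f \<in> ?F"
    then show "f \<in> (\<Union>t\<in>P. G t)"
      by (intro UN_I[of "restrict (kind \<circ> f) J"]) (auto simp: P_def G_def kind_def)
  qed
  moreover have "finite P" "card P = 3 ^ card J" using J by (simp_all add: P_def finite_PiE card_PiE)
  moreover have "finite (\<Union>t\<in>P. G t)"
    by (rule finite_subset[of _ "J \<rightarrow>\<^sub>E {..q}"]) (use J in \<open>auto simp: G_def finite_PiE\<close>)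
  ultimately have "card ?F \<le> (\<Sum>t\<in>P. card (G t))"
    by (intro order_trans[OF card_mono card_UN_le]) auto
  also have "\<dots> \<le> (\<Sum>t\<in>P. (q + 1) ^ R)" by (intro sum_mono card_G)
  also have "\<dots> = 3 ^ card J * (q + 1) ^ R" using \<open>card P = _\<close> by simp
  finally show ?thesis .
qed

context compact_dynamics
begin

text \<open>Bump values along the orbit are multiplied by \<open>q\<close> and rounded down. Points
  with equal codes differ by at most 1/q in every bump at every time, so one point per code spans.
  Values 0 and 1 give entries 0 and \<open>q\<close>, hence only fractional values can give
  intermediate entries.\<close>

lemma spanning_number_le_codes:
  fixes \<pi> :: "'i \<Rightarrow> 'a \<Rightarrow> real"
  assumes I: "finite I" and q: "q > 0"
    and range: "\<And>j x. j \<in> I \<Longrightarrow> 0 \<le> \<pi> j x" "\<And>j x. j \<in> I \<Longrightarrow> \<pi> j x \<le> 1"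
    and count: "\<And>x. (\<Sum>i<n. card {j\<in>I. 0 < \<pi> j ((T ^^ i) x) \<and> \<pi> j ((T ^^ i) x) < 1}) \<le> R"
    and near: "\<And>x y. (\<And>j. j \<in> I \<Longrightarrow> \<bar>\<pi> j x - \<pi> j y\<bar> \<le> 1 / real q) \<Longrightarrow> d x y < \<epsilon>"
  shows "spanning_number T n \<epsilon> d \<le> 3 ^ (n * card I) * (q + 1) ^ R"
proof -
  define J where "J = {..<n} \<times> I"
  define v where "v j x = nat \<lfloor>real q * \<pi> (snd j) ((T ^^ fst j) x)\<rfloor>" for j x
  define code where "code x = restrict (\<lambda>j. v j x) J" for x
  define F where "F = {f \<in> J \<rightarrow>\<^sub>E {..q}. card {j\<in>J. f j \<noteq> 0 \<and> f j \<noteq> q} \<le> R}"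
  have J: "finite J" "card J = n * card I" using I by (simp_all add: J_def card_cartesian_product)
  have codeF: "code x \<in> F" for x
  proof -
    have "v j x \<le> q" if "j \<in> J" for j
    proof -
      have "real q * \<pi> (snd j) ((T ^^ fst j) x) \<le> real q * 1"
        using that range(2) by (intro mult_left_mono) (auto simp: J_def)
      then show ?thesis unfolding v_def by linarith
    qed
    moreover have "card {j\<in>J. code x j \<noteq> 0 \<and> code x j \<noteq> q} \<le> R"
    proof -
      have frac: "0 < \<pi> (snd j) ((T ^^ fst j) x) \<and> \<pi> (snd j) ((T ^^ fst j) x) < 1"
        if "j \<in> J" "code x j \<noteq> 0 \<and> code x j \<noteq> q" for j
      proof -
        have "v j x \<noteq> 0" "v j x \<noteq> q" using that by (auto simp: code_def)
        then have "\<pi> (snd j) ((T ^^ fst j) x) \<noteq> 0" "\<pi> (snd j) ((T ^^ fst j) x) \<noteq> 1" by (auto simp: v_def)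
        moreover have "0 \<le> \<pi> (snd j) ((T ^^ fst j) x)" "\<pi> (snd j) ((T ^^ fst j) x) \<le> 1"
          using range that(1) by (auto simp: J_def)
        ultimately show ?thesis by simp
      qed
      have "{j\<in>J. code x j \<noteq> 0 \<and> code x j \<noteq> q}
        \<subseteq> (SIGMA i:{..<n}. {j\<in>I. 0 < \<pi> j ((T ^^ i) x) \<and> \<pi> j ((T ^^ i) x) < 1})"
      proof
        fix j assume "j \<in> {j\<in>J. code x j \<noteq> 0 \<and> code x j \<noteq> q}"
        then have "j \<in> J" and j: "0 < \<pi> (snd j) ((T ^^ fst j) x) \<and> \<pi> (snd j) ((T ^^ fst j) x) < 1"
          using frac[of j] by simp_all
        then show "j \<in> (SIGMA i:{..<n}. {j\<in>I. 0 < \<pi> j ((T ^^ i) x) \<and> \<pi> j ((T ^^ i) x) < 1})"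
          by (cases j) (simp add: J_def)
      qed
      then have "card {j\<in>J. code x j \<noteq> 0 \<and> code x j \<noteq> q}
        \<le> card (SIGMA i:{..<n}. {j\<in>I. 0 < \<pi> j ((T ^^ i) x) \<and> \<pi> j ((T ^^ i) x) < 1})"
        using I by (intro card_mono) auto
      also have "\<dots> \<le> R" using I count[of x] by simp
      finally show ?thesis .
    qed
    ultimately show ?thesis by (auto simp: F_def code_def)
  qed
  have finF: "finite F"
    by (rule finite_subset[of _ "J \<rightarrow>\<^sub>E {..q}"]) (use J in \<open>auto simp: F_def finite_PiE\<close>)
  define S where "S = inv code ` range code"
  have fin: "finite (range code)" using finF codeF by (auto intro: finite_subset[of _ F])
  have "spanning T n \<epsilon> d S"
    unfolding spanning_def
  proof
    fix x
    define y where "y = inv code (code x)"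
    have y: "code y = code x" unfolding y_def by (rule f_inv_into_f) simp
    have "d ((T ^^ k) x) ((T ^^ k) y) < \<epsilon>" if k: "k < n" for k
    proof (rule near)
      fix j assume j: "j \<in> I"
      then have "(k, j) \<in> J" using k by (simp add: J_def)
      then have "v (k, j) y = v (k, j) x" using fun_cong[OF y, of "(k, j)"] by (simp add: code_def)
      moreover have "int (v (k, j) z) = \<lfloor>real q * \<pi> j ((T ^^ k) z)\<rfloor>" for z
        using range(1)[OF j] by (simp add: v_def)
      ultimately have "\<lfloor>real q * \<pi> j ((T ^^ k) y)\<rfloor> = \<lfloor>real q * \<pi> j ((T ^^ k) x)\<rfloor>" by metis
      then have "\<bar>real q * \<pi> j ((T ^^ k) x) - real q * \<pi> j ((T ^^ k) y)\<bar> \<le> 1" by linarith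
      then have "real q * \<bar>\<pi> j ((T ^^ k) x) - \<pi> j ((T ^^ k) y)\<bar> \<le> 1"
        by (simp add: abs_mult flip: right_diff_distrib)
      then show "\<bar>\<pi> j ((T ^^ k) x) - \<pi> j ((T ^^ k) y)\<bar> \<le> 1 / real q"
        using q by (simp add: field_simps)
    qed
    moreover have "y \<in> S" by (simp add: S_def y_def)
    ultimately show "\<exists>y\<in>S. \<forall>k<n. d ((T ^^ k) x) ((T ^^ k) y) < \<epsilon>" by blast
  qed
  then have "spanning_number T n \<epsilon> d \<le> card S" using fin by (intro spanning_number_le) (auto simp: S_def)
  also have "\<dots> \<le> card (range code)" unfolding S_def using fin by (rule card_image_le)
  also have "\<dots> \<le> card F" using finF codeF by (intro card_mono) auto
  also have "\<dots> \<le> 3 ^ (n * card I) * (q + 1) ^ R" using card_codes_le[OF J(1), of q R] J(2) by (simp add: F_def)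
  finally show ?thesis .
qed

lemma scale_entropy_le:
  fixes \<pi> :: "'i \<Rightarrow> 'a \<Rightarrow> real"
  assumes I: "finite I" and q: "q > 0" and bumps: "bumps I W \<pi>"
    and count: "\<And>x n. real (\<Sum>i<n. card {j\<in>I. (T ^^ i) x \<in> W j}) \<le> real n * (1 + D) + C"
    and near: "\<And>x y. (\<And>j. j \<in> I \<Longrightarrow> \<bar>\<pi> j x - \<pi> j y\<bar> \<le> 1 / real q) \<Longrightarrow> d x y < \<epsilon>"
  shows "scale_entropy T \<epsilon> d \<le> ereal (real (card I) * ln 3 + D * ln (real (q + 1)))"
proof -
  note \<pi> = bumpsD[OF bumps]
  have frac: "real (\<Sum>i<n. card {j\<in>I. 0 < \<pi> j ((T ^^ i) x) \<and> \<pi> j ((T ^^ i) x) < 1}) \<le> real n * D + C" for n x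
  proof -
    \<comment> \<open>A bump with value 1 accounts for one unit of the multiplicity. This removes
      the 1 from \<open>1 + D\<close>.\<close>
    have excess: "Suc (card {j\<in>I. 0 < \<pi> j y \<and> \<pi> j y < 1}) \<le> card {j\<in>I. y \<in> W j}" for y
    proof -
      obtain j0 where j0: "j0 \<in> I" "\<pi> j0 y = 1" using \<pi>(5) by blast
      have "insert j0 {j\<in>I. 0 < \<pi> j y \<and> \<pi> j y < 1} \<subseteq> {j\<in>I. y \<in> W j}"
        using j0 \<pi>(4) by auto
      then have "card (insert j0 {j\<in>I. 0 < \<pi> j y \<and> \<pi> j y < 1}) \<le> card {j\<in>I. y \<in> W j}"
        using I by (intro card_mono) auto
      then show ?thesis using I j0 by simp
    qed
    have "(\<Sum>i<n. Suc (card {j\<in>I. 0 < \<pi> j ((T ^^ i) x) \<and> \<pi> j ((T ^^ i) x) < 1}))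
        \<le> (\<Sum>i<n. card {j\<in>I. (T ^^ i) x \<in> W j})" by (intro sum_mono excess)
    then have "n + (\<Sum>i<n. card {j\<in>I. 0 < \<pi> j ((T ^^ i) x) \<and> \<pi> j ((T ^^ i) x) < 1})
        \<le> (\<Sum>i<n. card {j\<in>I. (T ^^ i) x \<in> W j})" by (simp add: sum.distrib Suc_eq_plus1 del: One_nat_def)
    then have "real n + real (\<Sum>i<n. card {j\<in>I. 0 < \<pi> j ((T ^^ i) x) \<and> \<pi> j ((T ^^ i) x) < 1})
        \<le> real n * (1 + D) + C" using count[of x n] by linarith
    then show ?thesis by (simp add: algebra_simps)
  qed
  have step: "ln (real (spanning_number T n \<epsilon> d)) / real n
      \<le> real (card I) * ln 3 + D * ln (real (q + 1)) + C * ln (real (q + 1)) / real n" if n: "n \<ge> 1" for n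
  proof -
    \<comment> \<open>The bound dominates a cardinality, so rounding it down to the natural number
      \<open>R\<close> is legitimate.\<close>
    have nonneg: "0 \<le> real n * D + C" using frac[where n = n and x = undefined] by linarith
    define R where "R = nat \<lfloor>real n * D + C\<rfloor>"
    have R: "real R \<le> real n * D + C" using nonneg by (simp add: R_def)
    have lnq: "0 \<le> ln (real (q + 1))" by (intro ln_ge_zero) simp
    let ?B = "real n * real (card I) * ln 3 + (real n * D + C) * ln (real (q + 1))"
    have "spanning_number T n \<epsilon> d \<le> 3 ^ (n * card I) * (q + 1) ^ R"
    proof (rule spanning_number_le_codes[OF I q])
      show "(\<Sum>i<n. card {j\<in>I. 0 < \<pi> j ((T ^^ i) x) \<and> \<pi> j ((T ^^ i) x) < 1}) \<le> R" for x
        using frac[where n = n and x = x] unfolding R_def by linarith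
    qed (use \<pi> near in auto)
    then have "real (spanning_number T n \<epsilon> d) \<le> real (3 ^ (n * card I) * (q + 1) ^ R)" by (rule of_nat_mono)
    then have le: "real (spanning_number T n \<epsilon> d) \<le> 3 ^ (n * card I) * real (q + 1) ^ R"
      by (simp only: of_nat_mult of_nat_power of_nat_numeral)
    have "ln (real (spanning_number T n \<epsilon> d)) \<le> ?B"
    proof (cases "spanning_number T n \<epsilon> d = 0")
      case True
      then show ?thesis using nonneg lnq by simp
    next
      case False
      then have "ln (real (spanning_number T n \<epsilon> d)) \<le> ln (3 ^ (n * card I) * real (q + 1) ^ R)"
        using le by (intro ln_mono) auto
      also have "\<dots> = ln (3 ^ (n * card I)) + ln (real (q + 1) ^ R)"
        by (rule ln_mult_pos) auto
      also have "\<dots> = real n * real (card I) * ln 3 + real R * ln (real (q + 1))"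
        by (simp add: ln_realpow)
      also have "\<dots> \<le> ?B" using R lnq by (intro add_left_mono mult_right_mono)
      finally show ?thesis .
    qed
    then have "ln (real (spanning_number T n \<epsilon> d)) / real n \<le> ?B / real n" by (intro divide_right_mono) auto
    also have "\<dots> = real (card I) * ln 3 + D * ln (real (q + 1)) + C * ln (real (q + 1)) / real n"
      using n by (simp add: add_divide_distrib distrib_right)
    finally show ?thesis .
  qed
  let ?L = "real (card I) * ln 3 + D * ln (real (q + 1))"
  have "(\<lambda>n. ?L + C * ln (real (q + 1)) / real n) \<longlonglongrightarrow> ?L + 0"
    by (intro tendsto_add tendsto_const lim_const_over_n)
  then have eq: "limsup (\<lambda>n. ereal (?L + C * ln (real (q + 1)) / real n)) = ereal ?L"
    by (intro lim_imp_Limsup) auto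
  have "scale_entropy T \<epsilon> d \<le> limsup (\<lambda>n. ereal (?L + C * ln (real (q + 1)) / real n))"
    unfolding scale_entropy_def
    using step by (intro Limsup_mono eventually_sequentiallyI[of 1]) simp
  then show ?thesis unfolding eq .
qed

end

text \<open>Points need not be separated: the approximations below start from zero and depend on
  finitely many bumps. Continuity is asked at the diagonal only; the triangle inequality extends
  it.\<close>

definition continuous_pseudometric :: "('a::metric_space \<Rightarrow> 'a \<Rightarrow> real) \<Rightarrow> bool" where
  "continuous_pseudometric \<rho> \<longleftrightarrow> (\<forall>x. \<rho> x x = 0) \<and> (\<forall>x y. \<rho> x y = \<rho> y x) \<and>
     (\<forall>x y z. \<rho> x z \<le> \<rho> x y + \<rho> y z) \<and> (\<forall>x. \<forall>e>0. \<exists>r>0. \<forall>y. dist x y < r \<longrightarrow> \<rho> x y < e)"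

lemma continuous_pseudometricD:
  assumes "continuous_pseudometric \<rho>"
  shows "\<rho> x x = 0" "\<rho> x y = \<rho> y x" "\<rho> x z \<le> \<rho> x y + \<rho> y z" "0 \<le> \<rho> x y"
    and "e > 0 \<Longrightarrow> \<exists>r>0. \<forall>y. dist x y < r \<longrightarrow> \<rho> x y < e"
proof -
  show *: "\<rho> x x = 0" "\<rho> x y = \<rho> y x" "\<rho> x z \<le> \<rho> x y + \<rho> y z" for x y z
    using assms unfolding continuous_pseudometric_def by blast+
  show "0 \<le> \<rho> x y" using *(1)[of x] *(2)[of y x] *(3)[of x x y] by linarith
  show "e > 0 \<Longrightarrow> \<exists>r>0. \<forall>y. dist x y < r \<longrightarrow> \<rho> x y < e"
    using assms unfolding continuous_pseudometric_def by blast
qed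

lemma continuous_pseudometric_continuous_on:
  assumes "continuous_pseudometric \<rho>"
  shows "continuous_on A (\<rho> x)"
proof -
  note m = continuous_pseudometricD[OF assms]
  have "isCont (\<rho> x) y" for y
    unfolding continuous_at_eps_delta
  proof (intro allI impI)
    fix e :: real assume "e > 0"
    then obtain r where r: "r > 0" "\<forall>z. dist y z < r \<longrightarrow> \<rho> y z < e" using m(5) by blast
    have "dist (\<rho> x z) (\<rho> x y) < e" if "dist z y < r" for z
    proof -
      have "\<rho> y z < e" using r(2) that by (simp add: dist_commute)
      then show ?thesis using m(3)[of x z y] m(3)[of x y z] m(2)[of y z] by (simp add: dist_real_def)
    qed
    then show "\<exists>r>0. \<forall>z. dist z y < r \<longrightarrow> dist (\<rho> x z) (\<rho> x y) < e" using r(1) by blast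
  qed
  then show ?thesis by (simp add: continuous_at_imp_continuous_on)
qed

lemma continuous_pseudometric_bounded:
  assumes "compact (UNIV :: 'a::metric_space set)" "continuous_pseudometric (\<rho> :: 'a \<Rightarrow> 'a \<Rightarrow> real)"
  obtains B where "\<And>x y. \<rho> x y \<le> B"
proof -
  note m = continuous_pseudometricD[OF assms(2)]
  obtain y0 where y0: "\<And>y. \<rho> undefined y \<le> \<rho> undefined y0"
    using continuous_attains_sup[OF assms(1) _ continuous_pseudometric_continuous_on[OF assms(2)], of undefined]
    by auto
  have "\<rho> x y \<le> 2 * \<rho> undefined y0" for x y
    using m(3)[of x y undefined] m(2)[of x undefined] y0[of x] y0[of y] by linarith
  then show thesis by (rule that)
qed

text \<open>For open \<open>U\<close> containing \<open>x\<close>, the continuous function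
  \<open>\<rho> x\<close> attains its minimum on the compact complement, and by \<open>sep\<close>
  this minimum is the radius of a ball inside \<open>U\<close>. The converse inclusion of topologies
  is continuity.\<close>

lemma compatible_metricI:
  assumes "compact (UNIV :: 'a::metric_space set)" and \<rho>: "continuous_pseudometric (\<rho> :: 'a \<Rightarrow> 'a \<Rightarrow> real)"
    and sep: "\<And>x y. x \<noteq> y \<Longrightarrow> \<rho> x y > 0"
  shows "compatible_metric \<rho>"
proof -
  note m = continuous_pseudometricD[OF \<rho>]
  interpret M: Metric_space UNIV \<rho>
  proof
    show "\<rho> x y = 0 \<longleftrightarrow> x = y" for x y using m(1) sep[of x y] by force
    show "\<rho> x z \<le> \<rho> x y + \<rho> y z" for x y z by (rule m(3))
    show "\<rho> x y = \<rho> y x" "0 \<le> \<rho> x y" for x y by (rule m)+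
  qed
  have "openin M.mtopology U \<longleftrightarrow> open U" for U
  proof
    assume U: "openin M.mtopology U"
    show "open U"
      unfolding open_dist
    proof
      fix x assume "x \<in> U"
      then obtain e where e: "e > 0" "M.mball x e \<subseteq> U" using U M.openin_mtopology by blast
      then obtain r where r: "r > 0" "\<forall>y. dist x y < r \<longrightarrow> \<rho> x y < e" using m(5) by blast
      then have "\<forall>y. dist y x < r \<longrightarrow> y \<in> U" using e(2) by (auto simp: M.mball_def dist_commute)
      then show "\<exists>e>0. \<forall>y. dist y x < e \<longrightarrow> y \<in> U" using r(1) by blast
    qed
  next
    assume U: "open U"
    have "\<exists>e>0. M.mball x e \<subseteq> U" if x: "x \<in> U" for x
    proof (cases "U = UNIV")
      case True
      then show ?thesis by (intro exI[of _ 1]) auto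
    next
      case False
      have "compact (-U)" using assms(1) U closed_Int_compact[of "-U" UNIV] by auto
      then obtain y where y: "y \<in> -U" "\<And>z. z \<in> -U \<Longrightarrow> \<rho> x y \<le> \<rho> x z"
        using continuous_attains_inf[of "-U" "\<rho> x"] False continuous_pseudometric_continuous_on[OF \<rho>] by blast
      then have "M.mball x (\<rho> x y) \<subseteq> U" by (force simp: M.mball_def)
      moreover have "\<rho> x y > 0" using x y(1) by (intro sep) auto
      ultimately show ?thesis by blast
    qed
    then show "openin M.mtopology U" unfolding M.openin_mtopology by auto
  qed
  then have "M.mtopology = euclidean" by (simp add: topology_eq)
  then show ?thesis unfolding compatible_metric_def using M.Metric_space_axioms by simp
qed

lemma continuous_pseudometric_fine_cover:
  assumes "compact (UNIV :: 'a::metric_space set)" and \<rho>: "continuous_pseudometric (\<rho> :: 'a \<Rightarrow> 'a \<Rightarrow> real)"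
    and e: "e > 0"
  obtains \<alpha> where "\<alpha> \<in> finite_open_covers"
    "\<And>U x y. U \<in> \<alpha> \<Longrightarrow> x \<in> U \<Longrightarrow> y \<in> U \<Longrightarrow> \<rho> x y < e \<and> dist x y < e"
proof -
  note m = continuous_pseudometricD[OF \<rho>]
  have "\<forall>x. \<exists>r>0. \<forall>y. dist x y < r \<longrightarrow> \<rho> x y < e / 2" using e by (intro allI m(5)) simp
  from choice[OF this] obtain r where r: "\<And>x. r x > 0" "\<And>x y. dist x y < r x \<Longrightarrow> \<rho> x y < e / 2" by auto
  define U where "U x = ball x (min (r x) (e / 2))" for x
  obtain C where C: "finite C" "UNIV \<subseteq> (\<Union>x\<in>C. U x)"
  proof (rule compactE_image[OF assms(1), of UNIV U])
    show "open (U x)" for x by (simp add: U_def)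
    have "x \<in> U x" for x using r(1) e by (simp add: U_def)
    then show "UNIV \<subseteq> (\<Union>x\<in>UNIV. U x)" by blast
    fix C assume "finite C" "UNIV \<subseteq> (\<Union>x\<in>C. U x)"
    then show thesis by (rule that)
  qed
  show thesis
  proof (rule that[of "U ` C"])
    show "U ` C \<in> finite_open_covers" using C by (auto simp: finite_open_covers_def U_def)
    fix V x y assume "V \<in> U ` C" "x \<in> V" "y \<in> V"
    then obtain c where c: "dist c x < r c" "dist c x < e / 2" "dist c y < r c" "dist c y < e / 2"
      by (auto simp: U_def)
    have "\<rho> x y < e" using m(3)[of x y c] m(2)[of x c] r(2)[OF c(1)] r(2)[OF c(3)] by linarith
    moreover have "dist x y < e" using dist_triangle2[of x y c] dist_commute[of x c] dist_commute[of y c] c by linarith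
    ultimately show "\<rho> x y < e \<and> dist x y < e" by simp
  qed
qed

lemma abs_Max_diff_le:
  fixes f g :: "'i \<Rightarrow> real"
  assumes I: "finite I" "I \<noteq> {}" and le: "\<And>j. j \<in> I \<Longrightarrow> \<bar>f j - g j\<bar> \<le> e"
  shows "\<bar>Max (f ` I) - Max (g ` I)\<bar> \<le> e"
proof -
  have half: "Max (f ` I) \<le> Max (g ` I) + e" if "\<And>j. j \<in> I \<Longrightarrow> \<bar>f j - g j\<bar> \<le> e" for f g :: "'i \<Rightarrow> real"
  proof (rule Max.boundedI)
    fix a assume "a \<in> f ` I"
    then obtain j where j: "j \<in> I" "a = f j" by blast
    have "g j \<le> Max (g ` I)" using I j(1) by (intro Max_ge) auto
    then show "a \<le> Max (g ` I) + e" using that[OF j(1)] j(2) by linarith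
  qed (use I in auto)
  have "\<bar>g j - f j\<bar> \<le> e" if "j \<in> I" for j using le[OF that] by linarith
  from half[of f g, OF le] half[of g f, OF this] show ?thesis by linarith
qed

section \<open>Construction of the metric\<close>

context compact_system
begin

text \<open>By the Kuratowski embedding, \<rho> is the supremum distance between the functions
  \<rho>(x, z) of z. Replacing these by \<open>\<phi> z x\<close>, which sees \<open>x\<close> only
  through its bumps, changes the distance by at most \<open>2 * \<eta>\<close> and makes it
  Lipschitz in the bumps. The added \<open>c * gap\<close> separates points at distance \<delta>.
  The last two conclusions hold for all \<open>d\<close> within \<open>2 * \<tau>'\<close>, so they
  survive all later changes.\<close>

lemma metric_refinement:
  assumes marker: "marker_property T" and mdim: "\<And>\<alpha>. \<alpha> \<in> finite_open_covers \<Longrightarrow> cover_mdim \<alpha> \<le> D"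
    and \<rho>: "continuous_pseudometric \<rho>" and \<tau>: "\<tau> > 0" and \<delta>: "\<delta> > 0"
  obtains \<rho>' \<tau>' where "continuous_pseudometric \<rho>'" "0 < \<tau>'" "\<tau>' \<le> \<tau> / 2" "\<And>x y. \<bar>\<rho>' x y - \<rho> x y\<bar> \<le> \<tau>"
    "\<And>d x y. (\<And>x y. \<bar>d x y - \<rho>' x y\<bar> \<le> 2 * \<tau>') \<Longrightarrow> dist x y \<ge> \<delta> \<Longrightarrow> d x y > 0"
    "\<And>d. (\<And>x y. \<bar>d x y - \<rho>' x y\<bar> \<le> 2 * \<tau>') \<Longrightarrow>
      \<exists>\<epsilon>>0. \<epsilon> < 1 \<and> \<epsilon> < \<delta> \<and> scale_entropy T \<epsilon> d \<le> ereal ((D + \<delta>) * \<bar>ln \<epsilon>\<bar>)"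
proof -
  note m = continuous_pseudometricD[OF \<rho>]
  \<comment> \<open>The bound \<delta> keeps distant points out of a common member of the cover. The
    bound \<open>\<tau> / 4\<close> allows a change of \<open>2 * \<eta>\<close> in \<sigma>,
    together with \<open>c = \<tau> / 4\<close> for the gap term, within \<tau>.\<close>
  define \<eta> where "\<eta> = min \<delta> (\<tau> / 4)"
  have "\<eta> > 0" using \<tau> \<delta> by (simp add: \<eta>_def)
  obtain \<alpha> where \<alpha>: "\<alpha> \<in> finite_open_covers"
    "\<And>U x y. U \<in> \<alpha> \<Longrightarrow> x \<in> U \<Longrightarrow> y \<in> U \<Longrightarrow> \<rho> x y < \<eta> \<and> dist x y < \<eta>"
    by (rule continuous_pseudometric_fine_cover[OF compact \<rho> \<open>\<eta> > 0\<close>]) blast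
  define E where "E = D + \<delta> / 2"
  have "cover_mdim \<alpha> < E" using mdim[OF \<alpha>(1)] \<delta> by (simp add: E_def)
  obtain W :: "nat \<times> nat \<Rightarrow> 'a set" and I C where I: "finite I" and W: "\<And>j. j \<in> I \<Longrightarrow> open (W j)"
    "(\<Union>j\<in>I. W j) = UNIV" "\<And>j. j \<in> I \<Longrightarrow> \<exists>U\<in>\<alpha>. W j \<subseteq> U"
    and count: "\<And>x n. real (\<Sum>i<n. card {j\<in>I. (T ^^ i) x \<in> W j}) \<le> real n * (1 + E) + C"
  proof (rule small_mean_order_cover[OF marker \<alpha>(1) \<open>cover_mdim \<alpha> < E\<close>], goal_cases)
    case (1 W I C)
    from 1(2-) show ?case by (rule 1(1))
  qed
  obtain \<pi> where bumps: "bumps I W \<pi>" by (rule bumps_exist[OF compact I W(1,2)])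
  note \<pi> = bumpsD[OF bumps]
  have small: "\<rho> x y < \<eta> \<and> dist x y < \<eta>" if j: "j \<in> I" and xy: "x \<in> W j" "y \<in> W j" for j x y
  proof -
    obtain U where "U \<in> \<alpha>" "W j \<subseteq> U" using W(3)[OF j] by blast
    then show ?thesis using \<alpha>(2)[of U x y] xy by blast
  qed
  have I_ne: "I \<noteq> {}" using W(2) by auto
  obtain B0 where B0: "\<And>x y. \<rho> x y \<le> B0" using continuous_pseudometric_bounded[OF compact \<rho>] by blast
  define B where "B = \<bar>B0\<bar>"
  have B: "\<rho> x y \<le> B" "0 \<le> B" for x y using B0[of x y] by (auto simp: B_def)
  define c where "c = \<tau> / 4"
  have c: "c > 0" using \<tau> by (simp add: c_def)
  \<comment> \<open>For empty \<open>W j\<close> the bump \<open>\<pi> j\<close> is identically 0,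
    so its term in \<phi> is 0 for any choice of the point.\<close>
  define pt where "pt j = (SOME x. x \<in> W j)" for j
  define \<phi> where "\<phi> z x = Max ((\<lambda>j. \<pi> j x * \<rho> (pt j) z) ` I)" for z x
  define gap where "gap x y = Max ((\<lambda>j. \<bar>\<pi> j x - \<pi> j y\<bar>) ` I)" for x y
  define \<sigma> where "\<sigma> x y = (SUP z. \<bar>\<phi> z x - \<phi> z y\<bar>)" for x y
  define \<rho>' where "\<rho>' x y = \<sigma> x y + c * gap x y" for x y
  have gap_ge: "\<bar>\<pi> j x - \<pi> j y\<bar> \<le> gap x y" if "j \<in> I" for j x y
    unfolding gap_def using I that by (intro Max_ge) auto
  have gap_le: "gap x y \<le> e" if "\<And>j. j \<in> I \<Longrightarrow> \<bar>\<pi> j x - \<pi> j y\<bar> \<le> e" for e x y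
    unfolding gap_def using I I_ne that by (intro Max.boundedI) auto
  have gap_less: "gap x y < e" if "\<And>j. j \<in> I \<Longrightarrow> \<bar>\<pi> j x - \<pi> j y\<bar> < e" for e x y
    unfolding gap_def using I I_ne that by (subst Max_less_iff) auto
  have gap_nonneg: "0 \<le> gap x y" for x y
  proof -
    obtain j where "j \<in> I" using I_ne by blast
    then show ?thesis using gap_ge[of j x y] by linarith
  qed
  have \<phi>_gap: "\<bar>\<phi> z x - \<phi> z y\<bar> \<le> B * gap x y" for x y z
    unfolding \<phi>_def
  proof (rule abs_Max_diff_le[OF I I_ne])
    fix j assume j: "j \<in> I"
    have "\<bar>\<pi> j x * \<rho> (pt j) z - \<pi> j y * \<rho> (pt j) z\<bar> = \<rho> (pt j) z * \<bar>\<pi> j x - \<pi> j y\<bar>"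
      using m(4)[of "pt j" z] by (simp add: abs_mult flip: left_diff_distrib)
    also have "\<dots> \<le> B * gap x y" using gap_ge[OF j] m(4) B by (intro mult_mono) auto
    finally show "\<bar>\<pi> j x * \<rho> (pt j) z - \<pi> j y * \<rho> (pt j) z\<bar> \<le> B * gap x y" .
  qed
  have \<phi>_near: "\<bar>\<phi> z x - \<rho> x z\<bar> \<le> \<eta>" for x z
  proof -
    have in_W: "pt j \<in> W j \<and> x \<in> W j" if "j \<in> I" "\<pi> j x > 0" for j
    proof -
      have "x \<in> W j" using \<pi>(4) that by blast
      then show ?thesis unfolding pt_def by (metis someI)
    qed
    have "\<phi> z x \<le> \<rho> x z + \<eta>"
      unfolding \<phi>_def
    proof (rule Max.boundedI)
      fix a assume "a \<in> (\<lambda>j. \<pi> j x * \<rho> (pt j) z) ` I"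
      then obtain j where j: "j \<in> I" "a = \<pi> j x * \<rho> (pt j) z" by blast
      show "a \<le> \<rho> x z + \<eta>"
      proof (cases "\<pi> j x > 0")
        case True
        then have "\<rho> (pt j) x < \<eta>" using in_W[OF j(1)] small[OF j(1)] by blast
        moreover have "a \<le> 1 * \<rho> (pt j) z" unfolding j(2) using \<pi>(3)[OF j(1)] m(4) by (intro mult_right_mono) auto
        ultimately show ?thesis using m(3)[of "pt j" z x] by linarith
      next
        case False
        then have "a = 0" using \<pi>(2)[OF j(1), of x] by (simp add: j(2))
        then show ?thesis using m(4)[of x z] \<open>\<eta> > 0\<close> by linarith
      qed
    qed (use I I_ne in auto)
    moreover have "\<rho> x z - \<eta> \<le> \<phi> z x"
    proof -
      obtain j where j: "j \<in> I" "\<pi> j x = 1" using \<pi>(5) by blast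
      then have "\<rho> x (pt j) < \<eta>" using in_W[OF j(1)] small[OF j(1)] by simp
      then have "\<rho> x z - \<eta> \<le> \<pi> j x * \<rho> (pt j) z" using m(3)[of x z "pt j"] j(2) by simp
      also have "\<dots> \<le> \<phi> z x" unfolding \<phi>_def using I j(1) by (intro Max_ge) auto
      finally show ?thesis .
    qed
    ultimately show ?thesis by linarith
  qed
  have bdd: "bdd_above (range (\<lambda>z. \<bar>\<phi> z x - \<phi> z y\<bar>))" for x y
    using \<phi>_gap by (intro bdd_aboveI[of _ "B * gap x y"]) auto
  have \<sigma>_ge: "\<bar>\<phi> z x - \<phi> z y\<bar> \<le> \<sigma> x y" for x y z
    unfolding \<sigma>_def by (rule cSUP_upper[OF _ bdd]) simp
  have \<sigma>_le: "\<sigma> x y \<le> e" if "\<And>z. \<bar>\<phi> z x - \<phi> z y\<bar> \<le> e" for x y e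
    unfolding \<sigma>_def using that by (intro cSUP_least) auto
  have \<sigma>_nonneg: "0 \<le> \<sigma> x y" for x y
    using \<sigma>_ge[of undefined x y] by linarith
  have \<sigma>_near: "\<bar>\<sigma> x y - \<rho> x y\<bar> \<le> 2 * \<eta>" for x y
  proof -
    have "\<bar>\<phi> z x - \<phi> z y\<bar> \<le> \<rho> x y + 2 * \<eta>" for z
      using \<phi>_near[of z x] \<phi>_near[of z y] m(3)[of x z y] m(3)[of y z x] m(2)[of x y] by linarith
    then have "\<sigma> x y \<le> \<rho> x y + 2 * \<eta>" by (rule \<sigma>_le)
    moreover have "\<rho> x y - 2 * \<eta> \<le> \<bar>\<phi> y x - \<phi> y y\<bar>"
      using \<phi>_near[of y x] \<phi>_near[of y y] m(1)[of y] by linarith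
    ultimately show ?thesis using \<sigma>_ge[of y x y] by linarith
  qed
  have \<rho>'_gap: "\<rho>' x y \<le> (B + c) * gap x y" for x y
    using \<sigma>_le[OF \<phi>_gap, of x y] by (simp add: \<rho>'_def distrib_right)
  have pm: "continuous_pseudometric \<rho>'"
    unfolding continuous_pseudometric_def
  proof (intro conjI allI impI)
    fix x
    have "gap x x \<le> 0" by (rule gap_le) simp
    moreover have "\<sigma> x x \<le> 0" by (rule \<sigma>_le) simp
    ultimately show "\<rho>' x x = 0" using gap_nonneg[of x x] \<sigma>_nonneg[of x x] by (simp add: \<rho>'_def)
  next
    fix x y show "\<rho>' x y = \<rho>' y x" by (simp add: \<rho>'_def \<sigma>_def gap_def abs_minus_commute)
  next
    fix x y z
    have "\<bar>\<phi> w x - \<phi> w z\<bar> \<le> \<sigma> x y + \<sigma> y z" for w using \<sigma>_ge[of w x y] \<sigma>_ge[of w y z] by linarith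
    then have "\<sigma> x z \<le> \<sigma> x y + \<sigma> y z" by (rule \<sigma>_le)
    moreover have "gap x z \<le> gap x y + gap y z"
    proof (rule gap_le)
      fix j assume "j \<in> I"
      then show "\<bar>\<pi> j x - \<pi> j z\<bar> \<le> gap x y + gap y z" using gap_ge[of j x y] gap_ge[of j y z] by linarith
    qed
    then have "c * gap x z \<le> c * (gap x y + gap y z)" using c by (intro mult_left_mono) auto
    ultimately show "\<rho>' x z \<le> \<rho>' x y + \<rho>' y z" unfolding \<rho>'_def by (simp add: distrib_left)
  next
    fix x and e :: real assume e: "e > 0"
    define e' where "e' = e / (B + c)"
    have e': "e' > 0" using e B(2) c by (simp add: e'_def)
    have "\<exists>r>0. \<forall>y. dist x y < r \<longrightarrow> \<bar>\<pi> j x - \<pi> j y\<bar> < e'" if "j \<in> I" for j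
    proof -
      have "isCont (\<pi> j) x" using \<pi>(1)[OF that] by (simp add: continuous_on_eq_continuous_at)
      then obtain r where "r > 0" "\<forall>y. dist y x < r \<longrightarrow> dist (\<pi> j y) (\<pi> j x) < e'"
        using e' unfolding continuous_at_eps_delta by blast
      then show ?thesis by (intro exI[of _ r]) (auto simp: dist_real_def dist_commute abs_minus_commute)
    qed
    then obtain r where r: "\<And>j. j \<in> I \<Longrightarrow> r j > 0"
      "\<And>j y. j \<in> I \<Longrightarrow> dist x y < r j \<Longrightarrow> \<bar>\<pi> j x - \<pi> j y\<bar> < e'" by metis
    have "\<rho>' x y < e" if y: "dist x y < Min (r ` I)" for y
    proof -
      have "gap x y < e'"
      proof (rule gap_less)
        fix j assume j: "j \<in> I"
        have "Min (r ` I) \<le> r j" using I j by (intro Min_le) auto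
        then show "\<bar>\<pi> j x - \<pi> j y\<bar> < e'" using y by (intro r(2)[OF j]) simp
      qed
      then have "(B + c) * gap x y < e" using B(2) c by (simp add: e'_def field_simps)
      then show ?thesis using \<rho>'_gap[of x y] by linarith
    qed
    moreover have "Min (r ` I) > 0" using I I_ne r(1) by simp
    ultimately show "\<exists>r>0. \<forall>y. dist x y < r \<longrightarrow> \<rho>' x y < e" by blast
  qed
  have close: "\<bar>\<rho>' x y - \<rho> x y\<bar> \<le> \<tau>" for x y
  proof -
    have "gap x y \<le> 1"
    proof (rule gap_le)
      fix j assume "j \<in> I"
      then show "\<bar>\<pi> j x - \<pi> j y\<bar> \<le> 1" using \<pi>(2,3)[of j x] \<pi>(2,3)[of j y] by linarith
    qed
    then have "c * gap x y \<le> c * 1" "0 \<le> c * gap x y" using c gap_nonneg by (intro mult_left_mono mult_nonneg_nonneg; simp)+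
    moreover have "\<eta> \<le> \<tau> / 4" by (simp add: \<eta>_def)
    ultimately show ?thesis using \<sigma>_near[of x y] unfolding \<rho>'_def c_def by linarith
  qed
  have separated: "c \<le> \<rho>' x y" if "dist x y \<ge> \<delta>" for x y
  proof -
    obtain j where j: "j \<in> I" "\<pi> j x = 1" using \<pi>(5) by blast
    have "x \<in> W j" using \<pi>(4) j by simp
    have "\<not> \<pi> j y > 0"
    proof
      assume "\<pi> j y > 0"
      then have "dist x y < \<eta>" using small[OF j(1) \<open>x \<in> W j\<close>] \<pi>(4)[OF j(1)] by blast
      then show False using that by (simp add: \<eta>_def)
    qed
    then have "1 \<le> gap x y" using gap_ge[OF j(1), of x y] \<pi>(2)[OF j(1), of y] j(2) by linarith
    then have "c * 1 \<le> c * gap x y" using c by (intro mult_left_mono) auto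
    then show ?thesis using \<sigma>_nonneg[of x y] by (simp add: \<rho>'_def)
  qed
  define b where "b = ln (B + c + 1)"
  have "cover_mdim \<alpha> \<le> D" by (rule mdim[OF \<alpha>(1)])
  then have "0 \<le> D" using cover_mdim_nonneg[OF \<alpha>(1)] by linarith
  \<comment> \<open>All terms of the final estimate without a factor \<open>ln (real q)\<close>:
    from |ln \<epsilon>| = ln q - b, from the patterns of the codes, and from ln (q + 1) \<le> ln 2
    + ln q. The surplus \<delta>/2 of \<open>D + \<delta>\<close> over \<open>E\<close> absorbs them
    for large \<open>q\<close>.\<close>
  define K where "K = (D + \<delta>) * b + real (card I) * ln 3 + E * ln 2"
  have "filterlim (\<lambda>q. ln (real q)) at_top sequentially"
    by (rule filterlim_compose[OF ln_at_top filterlim_real_sequentially])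
  then have ev1: "\<forall>\<^sub>F q in sequentially. 2 * K / \<delta> \<le> ln (real q)" by (auto simp: filterlim_at_top)
  have ev2: "\<forall>\<^sub>F q in sequentially. (B + c + 1) / min 1 \<delta> < real q"
    using filterlim_real_sequentially by (auto simp: filterlim_at_top_dense)
  from eventually_happens'[OF sequentially_bot
      eventually_conj[OF ev1 eventually_conj[OF ev2 eventually_gt_at_top[of "0::nat"]]]]
  obtain q :: nat where q: "2 * K / \<delta> \<le> ln (real q)" "(B + c + 1) / min 1 \<delta> < real q" "q > 0" by blast
  \<comment> \<open>Equal codes give \<rho>'-distance at most (B + c)/q; the extra 1/q is room for
    later changes of the metric.\<close>
  define \<epsilon> where "\<epsilon> = (B + c + 1) / real q"
  have "B + c + 1 < real q * min 1 \<delta>" using q(2) \<delta> pos_divide_less_eq[of "min 1 \<delta>"] by simp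
  then have "B + c + 1 < min 1 \<delta> * real q" by (simp only: mult.commute)
  moreover have "real q > 0" using q(3) by simp
  ultimately have "\<epsilon> < min 1 \<delta>" unfolding \<epsilon>_def by (simp only: pos_divide_less_eq)
  moreover have "\<epsilon> > 0" using q(3) B(2) c by (simp add: \<epsilon>_def)
  ultimately have \<epsilon>: "\<epsilon> > 0" "\<epsilon> < min 1 \<delta>" by simp_all
  define h where "h = 1 / real q"
  have h: "h > 0" using q(3) by (simp add: h_def)
  define \<tau>' where "\<tau>' = min (\<tau> / 2) (min (c / 4) (h / 4))"
  have \<tau>': "0 < \<tau>'" "\<tau>' \<le> \<tau> / 2" "2 * \<tau>' < c" "2 * \<tau>' < h"
  proof -
    have le: "\<tau>' \<le> \<tau> / 2" "\<tau>' \<le> c / 4" "\<tau>' \<le> h / 4" by (auto simp: \<tau>'_def)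
    show "2 * \<tau>' < h" using le h by linarith
    show "2 * \<tau>' < c" using le c by linarith
    show "\<tau>' \<le> \<tau> / 2" by (rule le(1))
    show "0 < \<tau>'" using \<tau> c h by (simp add: \<tau>'_def)
  qed
  show thesis
  proof (rule that[OF pm \<tau>'(1,2) close])
    fix d :: "'a \<Rightarrow> 'a \<Rightarrow> real" and x y :: 'a
    assume "\<And>x y. \<bar>d x y - \<rho>' x y\<bar> \<le> 2 * \<tau>'" "dist x y \<ge> \<delta>"
    then show "d x y > 0" using separated[of x y] \<tau>'(3) by (smt (verit))
  next
    fix d :: "'a \<Rightarrow> 'a \<Rightarrow> real" assume d: "\<And>x y. \<bar>d x y - \<rho>' x y\<bar> \<le> 2 * \<tau>'"
    have "scale_entropy T \<epsilon> d \<le> ereal (real (card I) * ln 3 + E * ln (real (q + 1)))"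
    proof (rule scale_entropy_le[OF I q(3) bumps count])
      fix x y assume "\<And>j. j \<in> I \<Longrightarrow> \<bar>\<pi> j x - \<pi> j y\<bar> \<le> 1 / real q"
      then have "gap x y \<le> 1 / real q" by (rule gap_le)
      then have "(B + c) * gap x y \<le> (B + c) * (1 / real q)" using B(2) c by (intro mult_left_mono) auto
      then have "\<rho>' x y \<le> (B + c) * (1 / real q)" using \<rho>'_gap[of x y] by linarith
      then have "d x y < (B + c) * (1 / real q) + h" using d[of x y] \<tau>'(4) by linarith
      also have "\<dots> = \<epsilon>" by (simp add: \<epsilon>_def h_def add_divide_distrib)
      finally show "d x y < \<epsilon>" .
    qed
    also have "real (card I) * ln 3 + E * ln (real (q + 1)) \<le> (D + \<delta>) * \<bar>ln \<epsilon>\<bar>"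
    proof -
      have "\<bar>ln \<epsilon>\<bar> = - ln \<epsilon>" using \<epsilon> by simp
      also have "\<dots> = ln (real q) - b" unfolding \<epsilon>_def b_def using B(2) c q(3) by (simp add: ln_div)
      finally have ln\<epsilon>: "\<bar>ln \<epsilon>\<bar> = ln (real q) - b" .
      have "ln (real (q + 1)) \<le> ln (2 * real q)" using q(3) by (intro ln_mono) auto
      also have "\<dots> = ln 2 + ln (real q)" using q(3) by (intro ln_mult_pos) auto
      finally have "E * ln (real (q + 1)) \<le> E * (ln 2 + ln (real q))"
        using \<open>0 \<le> D\<close> \<delta> by (intro mult_left_mono) (auto simp: E_def)
      moreover have "K \<le> \<delta> / 2 * ln (real q)" using q(1) \<delta> by (simp add: field_simps)
      moreover have "(D + \<delta>) * ln (real q) = E * ln (real q) + \<delta> / 2 * ln (real q)"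
        by (simp add: E_def algebra_simps)
      ultimately show ?thesis unfolding ln\<epsilon> K_def by (simp add: algebra_simps)
    qed
    finally have "scale_entropy T \<epsilon> d \<le> ereal ((D + \<delta>) * \<bar>ln \<epsilon>\<bar>)" by simp
    then show "\<exists>\<epsilon>>0. \<epsilon> < 1 \<and> \<epsilon> < \<delta> \<and> scale_entropy T \<epsilon> d \<le> ereal ((D + \<delta>) * \<bar>ln \<epsilon>\<bar>)"
      using \<epsilon> by auto
  qed
qed

lemma metric_mdim_le:
  assumes scales: "\<And>\<delta>. \<delta> > 0 \<Longrightarrow>
    \<exists>\<epsilon>>0. \<epsilon> < 1 \<and> \<epsilon> < \<delta> \<and> scale_entropy T \<epsilon> d \<le> ereal ((D + \<delta>) * \<bar>ln \<epsilon>\<bar>)"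
  shows "metric_mdim T d \<le> ereal D"
proof (rule ccontr)
  assume "\<not> ?thesis"
  then have "ereal D < metric_mdim T d" by simp
  from ereal_dense2[OF this] obtain y where y: "ereal D < ereal y" "ereal y < metric_mdim T d" by blast
  then have "\<forall>\<^sub>F \<epsilon> in at_right 0. ereal y < scale_entropy T \<epsilon> d / ereal \<bar>ln \<epsilon>\<bar>"
    unfolding metric_mdim_def by (intro less_LiminfD)
  then obtain b :: real where b: "b > 0" "\<And>\<epsilon>. 0 < \<epsilon> \<Longrightarrow> \<epsilon> < b \<Longrightarrow> ereal y < scale_entropy T \<epsilon> d / ereal \<bar>ln \<epsilon>\<bar>"
    unfolding eventually_at_right_field by auto
  \<comment> \<open>The bound \<open>b\<close> puts the scale provided for \<delta> into the range
    of the strict inequality, and the bound \<open>y - D\<close> makes its ratio at most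
    \<open>y\<close>.\<close>
  define \<delta> where "\<delta> = min b (y - D)"
  have "\<delta> > 0" using b(1) y(1) by (simp add: \<delta>_def)
  then obtain \<epsilon> where \<epsilon>: "\<epsilon> > 0" "\<epsilon> < 1" "\<epsilon> < \<delta>" "scale_entropy T \<epsilon> d \<le> ereal ((D + \<delta>) * \<bar>ln \<epsilon>\<bar>)"
    using scales by blast
  have pos: "\<bar>ln \<epsilon>\<bar> > 0" using \<epsilon> by simp
  have "ereal y < scale_entropy T \<epsilon> d / ereal \<bar>ln \<epsilon>\<bar>" using \<epsilon> by (intro b(2)) (auto simp: \<delta>_def)
  also have "\<dots> \<le> ereal ((D + \<delta>) * \<bar>ln \<epsilon>\<bar>) / ereal \<bar>ln \<epsilon>\<bar>"
    using \<epsilon>(4) pos by (intro ereal_divide_right_mono) auto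
  also have "\<dots> = ereal (D + \<delta>)" using pos by simp
  also have "\<dots> \<le> ereal y" by (simp add: \<delta>_def)
  finally show False by simp
qed

text \<open>A sequence of pseudometrics with tolerances that at least halve: each step changes
  values by no more than the current tolerance, so all changes from stage n on add up to at most
  twice that tolerance. The limit stays in every range for which \<open>good\<close> was
  established, and thus inherits separation and a good scale from each stage.\<close>

lemma exists_metric:
  assumes marker: "marker_property T" and mdim: "\<And>\<alpha>. \<alpha> \<in> finite_open_covers \<Longrightarrow> cover_mdim \<alpha> \<le> D"
  obtains d where "compatible_metric d" "metric_mdim T d \<le> ereal D"
proof -
  define good where "good \<delta> p \<longleftrightarrow> (\<forall>d. (\<forall>x y. \<bar>d x y - fst p x y\<bar> \<le> 2 * snd p) \<longrightarrow>
      (\<forall>x y. dist x y \<ge> \<delta> \<longrightarrow> d x y > 0) \<and>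
      (\<exists>\<epsilon>>0. \<epsilon> < 1 \<and> \<epsilon> < \<delta> \<and> scale_entropy T \<epsilon> d \<le> ereal ((D + \<delta>) * \<bar>ln \<epsilon>\<bar>)))"
    for \<delta> :: real and p :: "('a \<Rightarrow> 'a \<Rightarrow> real) \<times> real"
  define ok where "ok p \<longleftrightarrow> continuous_pseudometric (fst p) \<and> snd p > 0" for p :: "('a \<Rightarrow> 'a \<Rightarrow> real) \<times> real"
  define step where "step n p p' \<longleftrightarrow> snd p' \<le> snd p / 2 \<and> (\<forall>x y. \<bar>fst p' x y - fst p x y\<bar> \<le> snd p) \<and>
      good (1 / real (Suc n)) p'" for n and p p' :: "('a \<Rightarrow> 'a \<Rightarrow> real) \<times> real"
  have "\<exists>s. \<forall>n. ok (s n) \<and> step n (s n) (s (Suc n))"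
  proof (rule dependent_nat_choice)
    \<comment> \<open>The zero pseudometric with tolerance 1 is a valid start.\<close>
    show "\<exists>p. ok p" by (intro exI[of _ "(\<lambda>_ _. 0, 1)"]) (auto simp: ok_def continuous_pseudometric_def intro: exI[of _ 1])
    fix p :: "('a \<Rightarrow> 'a \<Rightarrow> real) \<times> real" and n assume "ok p"
    then have p: "continuous_pseudometric (fst p)" "snd p > 0" by (auto simp: ok_def)
    have "1 / real (Suc n) > 0" by simp
    from metric_refinement[OF marker mdim p this]
    obtain \<rho>' \<tau>' where *: "continuous_pseudometric \<rho>'" "0 < \<tau>'" "\<tau>' \<le> snd p / 2"
      "\<And>x y. \<bar>\<rho>' x y - fst p x y\<bar> \<le> snd p"
      "\<And>d x y. (\<And>x y. \<bar>d x y - \<rho>' x y\<bar> \<le> 2 * \<tau>') \<Longrightarrow> dist x y \<ge> 1 / real (Suc n) \<Longrightarrow> d x y > 0"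
      "\<And>d. (\<And>x y. \<bar>d x y - \<rho>' x y\<bar> \<le> 2 * \<tau>') \<Longrightarrow>
        \<exists>\<epsilon>>0. \<epsilon> < 1 \<and> \<epsilon> < 1 / real (Suc n) \<and>
          scale_entropy T \<epsilon> d \<le> ereal ((D + 1 / real (Suc n)) * \<bar>ln \<epsilon>\<bar>)"
      by (metis (no_types))
    have "good (1 / real (Suc n)) (\<rho>', \<tau>')"
      unfolding good_def fst_conv snd_conv
    proof (intro allI impI conjI)
      fix d :: "'a \<Rightarrow> 'a \<Rightarrow> real" assume d: "\<forall>x y. \<bar>d x y - \<rho>' x y\<bar> \<le> 2 * \<tau>'"
      show "d x y > 0" if "dist x y \<ge> 1 / real (Suc n)" for x y by (rule *(5)) (use d that in auto)
      show "\<exists>\<epsilon>>0. \<epsilon> < 1 \<and> \<epsilon> < 1 / real (Suc n) \<and>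
          scale_entropy T \<epsilon> d \<le> ereal ((D + 1 / real (Suc n)) * \<bar>ln \<epsilon>\<bar>)" by (rule *(6)) (use d in auto)
    qed
    then have "ok (\<rho>', \<tau>') \<and> step n p (\<rho>', \<tau>')" using *(1-4) by (simp add: ok_def step_def)
    then show "\<exists>p'. ok p' \<and> step n p p'" by blast
  qed
  then obtain s where s: "\<And>n. ok (s n)" "\<And>n. step n (s n) (s (Suc n))" by blast
  define \<rho> where "\<rho> n = fst (s n)" for n
  define \<tau> where "\<tau> n = snd (s n)" for n
  have \<rho>: "continuous_pseudometric (\<rho> n)" and \<tau>: "\<tau> n > 0" "\<tau> (Suc n) \<le> \<tau> n / 2"
    and close: "\<bar>\<rho> (Suc n) x y - \<rho> n x y\<bar> \<le> \<tau> n" and good: "good (1 / real (Suc n)) (s (Suc n))" for n x y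
    using s(1)[of n] s(2)[of n] by (auto simp: ok_def step_def \<rho>_def \<tau>_def)
  \<comment> \<open>Subtracting \<open>2 * \<tau> (n + j)\<close> lets the induction close: halving
    gives \<open>\<tau> k \<le> 2 * \<tau> k - 2 * \<tau> (Suc k)\<close>.\<close>
  have near: "\<bar>\<rho> (n + j) x y - \<rho> n x y\<bar> \<le> 2 * \<tau> n - 2 * \<tau> (n + j)" for n j x y
  proof (induction j)
    case (Suc j)
    then show ?case using close[of "n + j" x y] \<tau>(2)[of "n + j"] by simp
  qed simp
  have \<tau>_bound: "\<tau> n \<le> \<tau> 0 * (1 / 2) ^ n" for n
  proof (induction n)
    case (Suc n)
    then show ?case using \<tau>(2)[of n] by simp
  qed simp
  have "(\<lambda>n. \<tau> 0 * (1 / 2) ^ n) \<longlonglongrightarrow> \<tau> 0 * 0"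
    by (intro tendsto_mult_left LIMSEQ_power_zero) simp
  then have upper: "(\<lambda>n. \<tau> 0 * (1 / 2) ^ n) \<longlonglongrightarrow> 0" by simp
  have \<tau>_lim: "\<tau> \<longlonglongrightarrow> 0"
  proof (rule tendsto_sandwich[OF _ _ tendsto_const upper])
    show "\<forall>\<^sub>F n in sequentially. 0 \<le> \<tau> n" by (intro always_eventually allI less_imp_le \<tau>(1))
    show "\<forall>\<^sub>F n in sequentially. \<tau> n \<le> \<tau> 0 * (1 / 2) ^ n" by (intro always_eventually allI \<tau>_bound)
  qed
  have "Cauchy (\<lambda>n. \<rho> n x y)" for x y
  proof (rule CauchyI')
    fix e :: real assume "e > 0"
    then have "\<forall>\<^sub>F n in sequentially. \<tau> n < e / 2" using order_tendstoD(2)[OF \<tau>_lim, of "e / 2"] by simp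
    then obtain M where M: "\<And>n. n \<ge> M \<Longrightarrow> \<tau> n < e / 2" by (auto simp: eventually_sequentially)
    have "dist (\<rho> m x y) (\<rho> n x y) < e" if "m \<ge> M" "n > m" for m n
    proof -
      have "\<bar>\<rho> n x y - \<rho> m x y\<bar> \<le> 2 * \<tau> m - 2 * \<tau> n" using near[of m "n - m" x y] that by simp
      then show ?thesis using M[OF that(1)] \<tau>(1)[of n] by (simp add: dist_real_def)
    qed
    then show "\<exists>M. \<forall>m\<ge>M. \<forall>n>m. dist (\<rho> m x y) (\<rho> n x y) < e" by blast
  qed
  then have "\<exists>l. (\<lambda>n. \<rho> n x y) \<longlonglongrightarrow> l" for x y using Cauchy_convergent by (auto simp: convergent_def)
  then obtain d where d: "\<And>x y. (\<lambda>n. \<rho> n x y) \<longlonglongrightarrow> d x y" by metis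
  have d_near: "\<bar>d x y - \<rho> n x y\<bar> \<le> 2 * \<tau> n" for n x y
  proof (rule tendsto_upperbound)
    show "(\<lambda>k. \<bar>\<rho> k x y - \<rho> n x y\<bar>) \<longlonglongrightarrow> \<bar>d x y - \<rho> n x y\<bar>" by (intro tendsto_intros d)
    have "\<bar>\<rho> k x y - \<rho> n x y\<bar> \<le> 2 * \<tau> n" if "k \<ge> n" for k
      using near[of n "k - n" x y] \<tau>(1)[of k] that by simp
    then show "\<forall>\<^sub>F k in sequentially. \<bar>\<rho> k x y - \<rho> n x y\<bar> \<le> 2 * \<tau> n"
      by (rule eventually_sequentiallyI)
  qed simp
  have pm: "continuous_pseudometric d"
    unfolding continuous_pseudometric_def
  proof (intro conjI allI impI)
    note m = continuous_pseudometricD[OF \<rho>]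
    fix x y z
    show "d x x = 0" using d[of x x] m(1) by (simp add: LIMSEQ_const_iff)
    show "d x y = d y x" using LIMSEQ_unique[OF d[of x y]] d[of y x] m(2)[of _ x y] by simp
    show "d x z \<le> d x y + d y z"
      by (rule LIMSEQ_le[OF d tendsto_add[OF d d]]) (use m(3) in auto)
    fix e :: real assume "e > 0"
    then have "\<forall>\<^sub>F n in sequentially. \<tau> n < e / 4" using order_tendstoD(2)[OF \<tau>_lim, of "e / 4"] by simp
    then obtain n where n: "\<tau> n < e / 4" by (auto simp: eventually_sequentially)
    obtain r where r: "r > 0" "\<forall>y. dist x y < r \<longrightarrow> \<rho> n x y < e / 2" using m(5)[of "e / 2" x n] \<open>e > 0\<close> by auto
    have "d x y < e" if "dist x y < r" for y
    proof -
      have "\<rho> n x y < e / 2" using r(2) that by blast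
      then show ?thesis using d_near[where x = x and y = y and n = n] n by linarith
    qed
    then show "\<exists>r>0. \<forall>y. dist x y < r \<longrightarrow> d x y < e" using r(1) by blast
  qed
  have goodD: "(\<forall>x y. dist x y \<ge> 1 / real (Suc n) \<longrightarrow> d x y > 0) \<and> (\<exists>\<epsilon>>0. \<epsilon> < 1 \<and> \<epsilon> < 1 / real (Suc n) \<and>
      scale_entropy T \<epsilon> d \<le> ereal ((D + 1 / real (Suc n)) * \<bar>ln \<epsilon>\<bar>))" for n
    using good[of n] d_near[where n = "Suc n"] unfolding good_def \<rho>_def \<tau>_def by blast
  have small: "\<exists>n. 1 / real (Suc n) < e" if "e > 0" for e :: real
    using reals_Archimedean[OF that] by (simp add: inverse_eq_divide)
  show thesis
  proof (rule that)
    show "compatible_metric d"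
    proof (rule compatible_metricI[OF compact pm])
      fix x y :: 'a assume "x \<noteq> y"
      then obtain n where "1 / real (Suc n) < dist x y" using small[of "dist x y"] by auto
      then show "d x y > 0" using goodD[of n] by (meson less_imp_le)
    qed
    show "metric_mdim T d \<le> ereal D"
    proof (rule metric_mdim_le)
      fix \<delta> :: real assume "\<delta> > 0"
      then obtain n where n: "1 / real (Suc n) < \<delta>" using small by blast
      obtain \<epsilon> where \<epsilon>: "\<epsilon> > 0" "\<epsilon> < 1" "\<epsilon> < 1 / real (Suc n)"
        "scale_entropy T \<epsilon> d \<le> ereal ((D + 1 / real (Suc n)) * \<bar>ln \<epsilon>\<bar>)" using goodD[of n] by blast
      have "(D + 1 / real (Suc n)) * \<bar>ln \<epsilon>\<bar> \<le> (D + \<delta>) * \<bar>ln \<epsilon>\<bar>" using n by (intro mult_right_mono) auto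
      then have "scale_entropy T \<epsilon> d \<le> ereal ((D + \<delta>) * \<bar>ln \<epsilon>\<bar>)"
        using \<epsilon>(4) by (meson ereal_less_eq(3) order_trans)
      then show "\<exists>\<epsilon>>0. \<epsilon> < 1 \<and> \<epsilon> < \<delta> \<and> scale_entropy T \<epsilon> d \<le> ereal ((D + \<delta>) * \<bar>ln \<epsilon>\<bar>)"
        using \<epsilon> n by (intro exI[of _ \<epsilon>]) auto
    qed
  qed
qed

end

theorem theorem8p1:
  fixes T :: "'a::metric_space \<Rightarrow> 'a"
  assumes "compact (UNIV :: 'a set)"
    and "homeomorphic_map euclidean euclidean T"
    and "marker_property T"
  shows "\<exists>d'. compatible_metric d' \<and> mdim T = metric_mdim T d'"
proof -
  obtain S where S: "homeomorphic_maps euclidean euclidean T S"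
    using assms(2) homeomorphic_map_maps by blast
  interpret compact_system T S
    by unfold_locales (use assms(1) S in \<open>auto simp: homeomorphic_maps_def\<close>)
  show ?thesis
  proof (cases "mdim T = \<infinity>")
    case True
    then have "mdim T = metric_mdim T dist" using mdim_le_metric_mdim[OF compatible_dist] by simp
    then show ?thesis using compatible_dist by blast
  next
    case False
    \<comment> \<open>A single cover bounds the supremum from below by a real number, which excludes
      negative infinity.\<close>
    have "{UNIV} \<in> (finite_open_covers :: 'a set set set)" by (simp add: finite_open_covers_def)
    then have "ereal (cover_mdim {UNIV}) \<le> mdim T" unfolding mdim_eq by (rule SUP_upper)
    then have "mdim T \<noteq> -\<infinity>" by auto
    with False obtain D where D: "mdim T = ereal D" by (cases "mdim T") auto
    have "cover_mdim \<alpha> \<le> D" if "\<alpha> \<in> finite_open_covers" for \<alpha>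
    proof -
      have "ereal (cover_mdim \<alpha>) \<le> mdim T" unfolding mdim_eq using that by (rule SUP_upper)
      then show ?thesis by (simp add: D)
    qed
    then obtain d where "compatible_metric d" "metric_mdim T d \<le> ereal D"
      using exists_metric[OF assms(3)] by blast
    then show ?thesis using mdim_le_metric_mdim D by (metis antisym)
  qed
qed

end
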